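(* Every finite weak spiral has bounded width.
   Context: An algebra $(A,f)$ is a weak spiral if $f$ is a commutative idempotent binary operation such that for every $x,y\in A$ the sequence $f(x,y),\,f(x,f(x,y)),\,f(x,f(x,f(x,y))),\dots$ is eventually constant. A finite idempotent algebra has bounded width if its constraint satisfaction problem is solvable by local consistency checking; by known theorems this is equivalent to having terms $g_0$ (ternary) and $h_0$ ($4$-ary) satisfying $$g_0(x,x,y)\approx g_0(x,y,x)\approx g_0(y,x,x)\approx h_0(x,x,x,y)\approx h_0(x,x,y,x)\approx h_0(x,y,x,x)\approx h_0(y,x,x,x),$$ which may be taken as the definition. *)

theory Defs
  imports Complex_Main
begin

definition weak_spiral :: "'a set \<Rightarrow> ('a \<Rightarrow> 'a \<Rightarrow> 'a) \<Rightarrow> bool" where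
  "weak_spiral A f \<longleftrightarrow>
     (\<forall>x\<in>A. \<forall>y\<in>A. f x y \<in> A) \<and>
     (\<forall>x\<in>A. \<forall>y\<in>A. f x y = f y x) \<and>
     (\<forall>x\<in>A. f x x = x) \<and>
     (\<forall>x\<in>A. \<forall>y\<in>A. \<exists>c. \<forall>\<^sub>F n in sequentially. (f x ^^ Suc n) y = c)"

datatype bterm = Var nat | Op bterm bterm

primrec tvars :: "bterm \<Rightarrow> nat set" where
  "tvars (Var i) = {i}"
| "tvars (Op s t) = tvars s \<union> tvars t"

primrec teval :: "('a \<Rightarrow> 'a \<Rightarrow> 'a) \<Rightarrow> (nat \<Rightarrow> 'a) \<Rightarrow> bterm \<Rightarrow> 'a" where
  "teval f v (Var i) = v i"
| "teval f v (Op s t) = f (teval f v s) (teval f v t)"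

definition nary_term :: "nat \<Rightarrow> bterm \<Rightarrow> bool" where
  "nary_term n t \<longleftrightarrow> tvars t \<subseteq> {..<n}"

text \<open>Meaningful only if \<open>length xs = n\<close> for an \<open>n\<close>-ary term.\<close>

definition term_op :: "('a \<Rightarrow> 'a \<Rightarrow> 'a) \<Rightarrow> bterm \<Rightarrow> 'a list \<Rightarrow> 'a" where
  "term_op f t xs = teval f (\<lambda>i. xs ! i) t"

text \<open>For a finite idempotent algebra, solvability of the constraint satisfaction
  problem by local consistency checking is equivalent to the existence of a ternary and a
  4-ary term satisfying the identities below; this existence is taken as the definition.
  It is to be used for finite \<open>A\<close> closed under an idempotent \<open>f\<close>.\<close>

definition bounded_width :: "'a set \<Rightarrow> ('a \<Rightarrow> 'a \<Rightarrow> 'a) \<Rightarrow> bool" where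
  "bounded_width A f \<longleftrightarrow>
     (\<exists>g h. nary_term 3 g \<and> nary_term 4 h \<and>
        (\<forall>x\<in>A. \<forall>y\<in>A.
           term_op f g [x, x, y] = term_op f g [x, y, x] \<and>
           term_op f g [x, y, x] = term_op f g [y, x, x] \<and>
           term_op f g [y, x, x] = term_op f h [x, x, x, y] \<and>
           term_op f h [x, x, x, y] = term_op f h [x, x, y, x] \<and>
           term_op f h [x, x, y, x] = term_op f h [x, y, x, x] \<and>
           term_op f h [x, y, x, x] = term_op f h [y, x, x, x]))"

end

theory Submission
  imports Defs
begin

text \<open>The two terms are read off a solution of a constraint network. Let \<open>F\<close> be the free algebra
  on \<open>x, y\<close>. For each scope \<open>S\<close> of three or four out of \<open>m\<close> variables let \<open>R S\<close> be the subalgebra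
  of \<open>F ^ S\<close> generated by the tuples with one entry \<open>y\<close> and all other entries \<open>x\<close>; tuples in scopes
  that share a variable must agree there. If \<open>m > 3 * card F\<close>, then a solution takes
  the same value \<open>d\<close> at four variables, so that both the ternary and the 4-ary relation contain the
  constant tuple \<open>d\<close>, and the terms that produce these tuples satisfy the identities.

  The network satisfies a condition in the style of the Prague strategies of Barto and Kozik, and
  every network of finite weak spirals with this condition is solvable, by induction on the
  size of the domains. A subalgebra \<open>C\<close> absorbs \<open>A\<close> if all sufficiently long products
  \<open>f c1 (f c2 (... (f cn a)))\<close> with factors in \<open>C\<close> lie in \<open>C\<close>. If some domain has a proper absorbing
  subalgebra, then the domains are restricted to absorbing subalgebras. Otherwise any linked subdirect
  relation between two domains is their full product, and the domains are restricted to one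
  class of a maximal congruence. Being weak spirals, the simple quotients are not affine: they contain
  a nontrivial edge \<open>x, x'\<close> with \<open>f x x' = x'\<close>.\<close>

text \<open>The obstacle is that a path relation of the restricted network is usually smaller than
  the old path relation cut down to the new domains, because all intermediate values must stay in
  these domains too. Hence consistency is not inherited for free. Both reductions keep a part of the
  old path relation that absorbs it, and \<open>consistent_restrict\<close> recovers the required
  walks from this part. For absorbing domains the new path relation itself absorbs the old one. For
  congruence classes a middle value must be found in the prescribed class. This is automatic if one
  of the two adjoining paths transports classes. Otherwise the danger is that the two end points
  determine the class in the middle, as in an affine algebra; the stabilisation of
  \<open>f x (f x (... y))\<close> excludes this.

  The initial network is consistent because scopes have at least three variables: two coordinates of
  a tuple are tied so weakly that after two changes of the shared variable a path relation is
  full.\<close>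

definition prod_op :: "('a \<Rightarrow> 'a \<Rightarrow> 'a) \<Rightarrow> ('b \<Rightarrow> 'b \<Rightarrow> 'b) \<Rightarrow> 'a \<times> 'b \<Rightarrow> 'a \<times> 'b \<Rightarrow> 'a \<times> 'b" where
  "prod_op f g p q = (f (fst p) (fst q), g (snd p) (snd q))"

lemma prod_op_Pair [simp]: "prod_op f g (a, b) (c, d) = (f a c, g b d)"
  by (simp add: prod_op_def)

definition subalg :: "('a \<Rightarrow> 'a \<Rightarrow> 'a) \<Rightarrow> 'a set \<Rightarrow> bool" where
  "subalg f A \<longleftrightarrow> (\<forall>x\<in>A. \<forall>y\<in>A. f x y \<in> A)"

lemma subalgD: "subalg f A \<Longrightarrow> x \<in> A \<Longrightarrow> y \<in> A \<Longrightarrow> f x y \<in> A"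
  by (simp add: subalg_def)

lemma subalg_relD:
  "subalg (prod_op f g) R \<Longrightarrow> (a, b) \<in> R \<Longrightarrow> (c, d) \<in> R \<Longrightarrow> (f a c, g b d) \<in> R"
  using subalgD[of "prod_op f g" R "(a, b)" "(c, d)"] by simp

lemma subalg_relI:
  "(\<And>a b c d. (a, b) \<in> R \<Longrightarrow> (c, d) \<in> R \<Longrightarrow> (f a c, g b d) \<in> R) \<Longrightarrow> subalg (prod_op f g) R"
  by (auto simp: subalg_def)

lemma subalg_Int: "subalg f A \<Longrightarrow> subalg f B \<Longrightarrow> subalg f (A \<inter> B)"
  by (auto simp: subalg_def)

lemma subalg_Times: "subalg f A \<Longrightarrow> subalg g B \<Longrightarrow> subalg (prod_op f g) (A \<times> B)"
  by (auto simp: subalg_def)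

lemma subalg_converse: "subalg (prod_op f g) R \<Longrightarrow> subalg (prod_op g f) (R\<inverse>)"
  by (rule subalg_relI) (auto dest: subalg_relD)

lemma subalg_relcomp:
  "subalg (prod_op f g) R \<Longrightarrow> subalg (prod_op g h) S \<Longrightarrow> subalg (prod_op f h) (R O S)"
  by (rule subalg_relI) (blast dest: subalg_relD)

definition comm_idem :: "('a \<Rightarrow> 'a \<Rightarrow> 'a) \<Rightarrow> 'a set \<Rightarrow> bool" where
  "comm_idem f A \<longleftrightarrow> (\<forall>x\<in>A. f x x = x) \<and> (\<forall>x\<in>A. \<forall>y\<in>A. f x y = f y x)"

lemma comm_idem_idem: "comm_idem f A \<Longrightarrow> x \<in> A \<Longrightarrow> f x x = x"
  by (simp add: comm_idem_def)

lemma comm_idem_comm: "comm_idem f A \<Longrightarrow> x \<in> A \<Longrightarrow> y \<in> A \<Longrightarrow> f x y = f y x"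
  unfolding comm_idem_def by blast

lemma comm_idem_subset: "comm_idem f A \<Longrightarrow> B \<subseteq> A \<Longrightarrow> comm_idem f B"
  unfolding comm_idem_def by blast

lemma subalg_Id_on: "subalg f A \<Longrightarrow> subalg (prod_op f f) (Id_on A)"
  by (rule subalg_relI) (auto dest: subalgD)

lemma subalg_relpow:
  assumes "subalg (prod_op f f) R"
  shows "subalg (prod_op f f) (R ^^ Suc n)"
proof (induction n)
  case (Suc n)
  then show ?case
    using subalg_relcomp[OF Suc assms] by simp
qed (simp add: assms)

text \<open>Reflexivity pads two chains to a common length, and chains of equal length can be
  multiplied step by step.\<close>

lemma subalg_trancl:
  assumes "subalg (prod_op f f) R" "\<And>x. x \<in> A \<Longrightarrow> (x, x) \<in> R" "R \<subseteq> A \<times> A"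
  shows "subalg (prod_op f f) (R\<^sup>+)"
proof (rule subalg_relI)
  fix a b c d
  assume "(a, b) \<in> R\<^sup>+" "(c, d) \<in> R\<^sup>+"
  have mono: "(x, y) \<in> R ^^ Suc (n + k)" if "(x, y) \<in> R ^^ Suc n" for n k x y
  proof (induction k)
    case (Suc k)
    have "y \<in> A" using that assms(3) by auto
    then have "(y, y) \<in> R" using assms(2) by blast
    then show ?case using Suc by auto
  qed (use that in simp)
  obtain m where m: "(a, b) \<in> R ^^ Suc m"
    using \<open>(a, b) \<in> R\<^sup>+\<close> by (metis trancl_power gr0_implies_Suc)
  obtain n where n: "(c, d) \<in> R ^^ Suc n"
    using \<open>(c, d) \<in> R\<^sup>+\<close> by (metis trancl_power gr0_implies_Suc)
  have "(a, b) \<in> R ^^ Suc (m + n)" "(c, d) \<in> R ^^ Suc (m + n)"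
    using mono[OF m, of n] mono[OF n, of m] by (simp_all only: add.commute)
  then have "(f a c, f b d) \<in> R ^^ Suc (m + n)"
    using subalg_relD[OF subalg_relpow[OF assms(1)]] by blast
  then show "(f a c, f b d) \<in> R\<^sup>+"
    by (metis trancl_power zero_less_Suc)
qed

subsection \<open>Absorption\<close>

text \<open>Only the innermost argument of the product may leave \<open>C\<close>, whereas the usual
  notion of absorption allows this for each argument of a term. The level makes this notion amenable
  to induction.\<close>

primrec absorb_level :: "('a \<Rightarrow> 'a \<Rightarrow> 'a) \<Rightarrow> 'a set \<Rightarrow> nat \<Rightarrow> 'a set" where
  "absorb_level f C 0 = C"
| "absorb_level f C (Suc k) = {a. \<forall>c\<in>C. f c a \<in> absorb_level f C k}"

definition absorbs :: "('a \<Rightarrow> 'a \<Rightarrow> 'a) \<Rightarrow> 'a set \<Rightarrow> 'a set \<Rightarrow> bool" where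
  "absorbs f C A \<longleftrightarrow> C \<noteq> {} \<and> C \<subseteq> A \<and> subalg f C \<and> (\<exists>k. A \<subseteq> absorb_level f C k)"

definition absorption_free :: "('a \<Rightarrow> 'a \<Rightarrow> 'a) \<Rightarrow> 'a set \<Rightarrow> bool" where
  "absorption_free f A \<longleftrightarrow> (\<forall>C. absorbs f C A \<longrightarrow> C = A)"

lemma absorbsI:
  "C \<noteq> {} \<Longrightarrow> C \<subseteq> A \<Longrightarrow> subalg f C \<Longrightarrow> A \<subseteq> absorb_level f C k \<Longrightarrow> absorbs f C A"
  unfolding absorbs_def by blast

lemma absorbs_refl: "subalg f A \<Longrightarrow> A \<noteq> {} \<Longrightarrow> absorbs f A A"
  by (rule absorbsI[where k = 0]) auto

lemma absorb_level_mono: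
  assumes "subalg f C" "k \<le> l"
  shows "absorb_level f C k \<subseteq> absorb_level f C l"
proof -
  have "absorb_level f C k \<subseteq> absorb_level f C (Suc k)" for k
    using assms(1) by (induction k) (auto simp: subalg_def)
  then show ?thesis
    using assms(2) lift_Suc_mono_le by blast
qed

text \<open>Factors from \<open>E\<close> lie in \<open>C\<close> as well, so the first
  \<open>l\<close> of them carry \<open>A\<close> into \<open>C\<close>, and \<open>k\<close> more
  carry \<open>C\<close> into \<open>E\<close>.\<close>

lemma absorbs_trans:
  assumes "absorbs f E C" "absorbs f C A"
  shows "absorbs f E A"
proof -
  obtain k l where k: "C \<subseteq> absorb_level f E k" and l: "A \<subseteq> absorb_level f C l"
    using assms unfolding absorbs_def by blast
  have "absorb_level f C n \<subseteq> absorb_level f E (n + k)" for n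
  proof (induction n)
    case (Suc n)
    then show ?case using assms(1) unfolding absorbs_def by auto
  qed (use k in simp)
  then have "A \<subseteq> absorb_level f E (l + k)" using l by blast
  then show ?thesis
    using assms unfolding absorbs_def by blast
qed

lemma absorbs_Int:
  assumes "absorbs f C A" "D \<subseteq> A" "subalg f D" "C \<inter> D \<noteq> {}"
  shows "absorbs f (C \<inter> D) D"
proof -
  obtain k where k: "A \<subseteq> absorb_level f C k"
    using assms unfolding absorbs_def by blast
  have "absorb_level f C n \<inter> D \<subseteq> absorb_level f (C \<inter> D) n" for n
  proof (induction n)
    case (Suc n)
    then show ?case using assms(3) by (auto simp: subalg_def)
  qed simp
  then have "D \<subseteq> absorb_level f (C \<inter> D) k"
    using k assms(2) by blast
  then show ?thesis
    using assms by (auto simp: absorbs_def intro: subalg_Int)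
qed

lemma absorbs_image:
  assumes "absorbs f C A" "subalg f A" "\<And>x y. x \<in> A \<Longrightarrow> y \<in> A \<Longrightarrow> h (f x y) = g (h x) (h y)"
  shows "absorbs g (h ` C) (h ` A)"
proof -
  obtain k where k: "A \<subseteq> absorb_level f C k"
    using assms unfolding absorbs_def by blast
  have CA: "C \<subseteq> A" "subalg f C" using assms unfolding absorbs_def by auto
  have "h ` (absorb_level f C n \<inter> A) \<subseteq> absorb_level g (h ` C) n" for n
  proof (induction n)
    case (Suc n)
    have "g (h c) (h a) \<in> absorb_level g (h ` C) n"
      if "a \<in> absorb_level f C (Suc n)" "a \<in> A" "c \<in> C" for a c
    proof -
      have "f c a \<in> absorb_level f C n \<inter> A"
        using that CA assms(2) by (auto simp: subalg_def)
      then have "h (f c a) \<in> absorb_level g (h ` C) n" using Suc by blast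
      then show ?thesis using assms(3) that CA by auto
    qed
    then show ?case by auto
  qed auto
  then have "h ` A \<subseteq> absorb_level g (h ` C) k"
    using k by blast
  moreover have "subalg g (h ` C)"
    unfolding subalg_def
  proof clarify
    fix x y
    assume "x \<in> C" "y \<in> C"
    then show "g (h x) (h y) \<in> h ` C"
      using assms(3)[of x y, symmetric] CA by (auto simp: subalg_def)
  qed
  ultimately show ?thesis
    using assms(1) unfolding absorbs_def by blast
qed

lemma absorbs_vimage:
  assumes "absorbs g D B" "subalg f A" "h ` A \<subseteq> B" "h ` A \<inter> D \<noteq> {}"
    "\<And>x y. x \<in> A \<Longrightarrow> y \<in> A \<Longrightarrow> h (f x y) = g (h x) (h y)"
  shows "absorbs f {a \<in> A. h a \<in> D} A"
proof -
  let ?C = "{a \<in> A. h a \<in> D}"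
  obtain k where k: "B \<subseteq> absorb_level g D k"
    using assms unfolding absorbs_def by blast
  have "a \<in> absorb_level f ?C n" if "a \<in> A" "h a \<in> absorb_level g D n" for n a
    using that
  proof (induction n arbitrary: a)
    case (Suc n)
    then show ?case using assms(2,5) by (auto simp: subalg_def)
  qed auto
  then have "A \<subseteq> absorb_level f ?C k"
    using k assms(3) by blast
  moreover have "subalg f ?C"
    using assms(1,2,5) unfolding subalg_def absorbs_def by auto
  ultimately show ?thesis
    using assms(4) unfolding absorbs_def by blast
qed

text \<open>A factor from \<open>P' O R'\<close> comes with a middle point; multiplying the old
  middle point by it keeps the two halves composable. The levels of both halves are raised to their
  maximum so that they fall in step.\<close>

lemma absorbs_relcomp:
  assumes "absorbs (prod_op f g) P' P" "absorbs (prod_op g h) R' R" "P' O R' \<noteq> {}"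
  shows "absorbs (prod_op f h) (P' O R') (P O R)"
proof -
  obtain k l where k: "P \<subseteq> absorb_level (prod_op f g) P' k"
    and l: "R \<subseteq> absorb_level (prod_op g h) R' l"
    using assms unfolding absorbs_def by blast
  have sub: "subalg (prod_op f g) P'" "subalg (prod_op g h) R'" "P' \<subseteq> P" "R' \<subseteq> R"
    using assms unfolding absorbs_def by auto
  have "(x, z) \<in> absorb_level (prod_op f h) (P' O R') n"
    if "(x, y) \<in> absorb_level (prod_op f g) P' n" "(y, z) \<in> absorb_level (prod_op g h) R' n"
    for x y z n
    using that
  proof (induction n arbitrary: x y z)
    case (Suc n)
    have "prod_op f h c (x, z) \<in> absorb_level (prod_op f h) (P' O R') n" if c: "c \<in> P' O R'" for c
    proof -
      obtain x' y' z' where c': "c = (x', z')" "(x', y') \<in> P'" "(y', z') \<in> R'"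
        using c by blast
      have "(f x' x, g y' y) \<in> absorb_level (prod_op f g) P' n"
        "(g y' y, h z' z) \<in> absorb_level (prod_op g h) R' n"
        using Suc.prems c'(2,3) by fastforce+
      from Suc.IH[OF this] show ?thesis using c'(1) by simp
    qed
    then show ?case by auto
  qed auto
  moreover have "P \<subseteq> absorb_level (prod_op f g) P' (max k l)"
    "R \<subseteq> absorb_level (prod_op g h) R' (max k l)"
    using k l absorb_level_mono[OF sub(1), of k "max k l"] absorb_level_mono[OF sub(2), of l "max k l"]
    by auto
  ultimately have "P O R \<subseteq> absorb_level (prod_op f h) (P' O R') (max k l)"
    by blast
  then show ?thesis
    using assms(3) sub subalg_relcomp[OF sub(1,2)] unfolding absorbs_def by blast
qed

section \<open>Absorption-free algebras and centers\<close>

lemma absorption_freeD: "absorption_free f A \<Longrightarrow> absorbs f C A \<Longrightarrow> C = A"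
  by (simp add: absorption_free_def)

text \<open>The projection of \<open>Z\<close> to \<open>A\<close> absorbs, hence is all of
  \<open>A\<close>. By idempotence each fibre \<open>{a} \<times> B\<close> is a subalgebra, so the
  part of \<open>Z\<close> in it projects to an absorbing subset of \<open>B\<close>, hence to all
  of \<open>B\<close>.\<close>

lemma absorption_free_Times:
  assumes A: "absorption_free f A" "subalg f A" "comm_idem f A"
    and B: "absorption_free g B" "subalg g B"
  shows "absorption_free (prod_op f g) (A \<times> B)"
  unfolding absorption_free_def
proof (intro allI impI)
  fix Z
  assume Z: "absorbs (prod_op f g) Z (A \<times> B)"
  have ne: "A \<noteq> {}" "B \<noteq> {}" using Z unfolding absorbs_def by auto
  have "absorbs f (fst ` Z) (fst ` (A \<times> B))"
    by (rule absorbs_image[OF Z]) (use A B in \<open>auto intro: subalg_Times\<close>)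
  then have fstZ: "fst ` Z = A"
    using absorption_freeD[OF A(1)] ne by simp
  have "(a, b) \<in> Z" if "a \<in> A" "b \<in> B" for a b
  proof -
    have D: "subalg (prod_op f g) ({a} \<times> B)"
      using that B(2) A(3) by (auto simp: subalg_def comm_idem_def)
    have "Z \<inter> ({a} \<times> B) \<noteq> {}"
      using fstZ that Z unfolding absorbs_def by fastforce
    then have "absorbs (prod_op f g) (Z \<inter> ({a} \<times> B)) ({a} \<times> B)"
      using absorbs_Int[OF Z _ D] that by blast
    then have "absorbs g (snd ` (Z \<inter> ({a} \<times> B))) (snd ` ({a} \<times> B))"
      by (rule absorbs_image) (use D in auto)
    then have "snd ` (Z \<inter> ({a} \<times> B)) = B"
      using absorption_freeD[OF B(1)] by simp
    then show ?thesis using that by force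
  qed
  then show "Z = A \<times> B"
    using Z unfolding absorbs_def by auto
qed

text \<open>Multiplying \<open>a\<close> by an element of the center replaces the neighbourhood of \<open>a\<close> by its
  product with \<open>B\<close>; this neighbourhood grows as long as it is not an ideal of \<open>B\<close>.\<close>

lemma center_absorbs:
  assumes R: "subalg (prod_op f g) R" "\<And>a. a \<in> A \<Longrightarrow> \<exists>b\<in>B. (a, b) \<in> R"
    and A: "subalg f A" and B: "subalg g B" "finite B" "comm_idem g B" "absorption_free g B"
    and ne: "{a \<in> A. \<forall>b\<in>B. (a, b) \<in> R} \<noteq> {}"
  shows "absorbs f {a \<in> A. \<forall>b\<in>B. (a, b) \<in> R} A"
proof -
  define C where "C = {a \<in> A. \<forall>b\<in>B. (a, b) \<in> R}"
  have subC: "subalg f C"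
    unfolding subalg_def
  proof (intro ballI)
    fix x y
    assume "x \<in> C" "y \<in> C"
    then have "(f x y, g b b) \<in> R" if "b \<in> B" for b
      using that subalg_relD[OF R(1)] unfolding C_def by blast
    then show "f x y \<in> C"
      using \<open>x \<in> C\<close> \<open>y \<in> C\<close> A B(3) unfolding C_def by (auto simp: comm_idem_def subalg_def)
  qed
  \<comment> \<open>\<open>n\<close> bounds the number of elements of \<open>B\<close> that are not
    neighbours of \<open>a\<close>; each multiplication by an element of \<open>C\<close> lowers
    this number.\<close>
  have level: "a \<in> absorb_level f C n"
    if "a \<in> A" "card B - card (R `` {a} \<inter> B) \<le> n" for a n
    using that
  proof (induction n arbitrary: a)
    case 0
    then have "R `` {a} \<inter> B = B"
      using B(2) by (metis Int_lower2 card_seteq diff_is_0_eq le_zero_eq)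
    then have "a \<in> C" using 0 unfolding C_def by auto
    then show ?case by simp
  next
    case (Suc n)
    let ?N = "R `` {a} \<inter> B"
    let ?I = "(\<lambda>(b, x). g b x) ` (B \<times> ?N)"
    show ?case
    proof (cases "?N = B")
      case True
      then have "a \<in> C" using Suc.prems unfolding C_def by auto
      then show ?thesis
        using absorb_level_mono[OF subC, of 0 "Suc n"] by auto
    next
      case False
      have NI: "?N \<subseteq> ?I"
      proof
        fix x
        assume "x \<in> ?N"
        moreover then have "g x x = x" using B(3) by (simp add: comm_idem_def)
        ultimately show "x \<in> ?I" by force
      qed
      have "?I \<noteq> ?N"
      proof
        assume eq: "?I = ?N"
        have cl: "g b x \<in> ?N" if "b \<in> B" "x \<in> ?N" for b x
          using that eq by blast
        \<comment> \<open>An ideal absorbs already at level 1.\<close>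
        have "absorbs g ?N B"
        proof (rule absorbsI[where k = 1])
          show "?N \<noteq> {}" using R(2)[OF Suc.prems(1)] by blast
          show "subalg g ?N" using cl by (auto simp: subalg_def)
          show "B \<subseteq> absorb_level g ?N 1"
            using cl comm_idem_comm[OF B(3)] by auto
        qed auto
        then show False using absorption_freeD[OF B(4)] False by blast
      qed
      then have lt: "card ?N < card ?I"
        using NI B(2) by (intro psubset_card_mono) auto
      have "f c a \<in> absorb_level f C n" if c: "c \<in> C" for c
      proof (rule Suc.IH)
        show "f c a \<in> A" using c Suc.prems(1) A unfolding C_def by (auto simp: subalg_def)
        have "?I \<subseteq> R `` {f c a} \<inter> B"
          using c subalg_relD[OF R(1)] B(1) unfolding C_def by (auto simp: subalg_def)
        then have "card ?I \<le> card (R `` {f c a} \<inter> B)"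
          using B(2) by (intro card_mono) auto
        then show "card B - card (R `` {f c a} \<inter> B) \<le> n"
          using lt Suc.prems(2) by linarith
      qed
      then show ?thesis by simp
    qed
  qed
  have "A \<subseteq> absorb_level f C (card B)"
    using level by auto
  then show ?thesis
    using ne subC unfolding absorbs_def C_def by blast
qed

text \<open>Fixing all but two members of a set of size \<open>n + 1\<close>, the pairs that have a neighbour in
  common with the fixed members form a relation whose center contains each fixed member.\<close>

lemma common_neighbour:
  assumes T: "subalg (prod_op g f) T" "T \<subseteq> Y \<times> X"
    and X: "subalg f X" "finite X" "comm_idem f X" "absorption_free f X" "X \<noteq> {}"
    and two: "\<And>x x'. x \<in> X \<Longrightarrow> x' \<in> X \<Longrightarrow> \<exists>y. (y, x) \<in> T \<and> (y, x') \<in> T"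
  shows "\<exists>y. \<forall>x\<in>X. (y, x) \<in> T"
proof -
  have "\<exists>y. \<forall>x\<in>F. (y, x) \<in> T" if "F \<subseteq> X" "card F = n" "F \<noteq> {}" for F n
    using that
  proof (induction n arbitrary: F rule: less_induct)
    case (less n)
    have finF: "finite F" using less.prems X(2) finite_subset by blast
    obtain x1 where x1: "x1 \<in> F" using less.prems by blast
    show ?case
    proof (cases "\<exists>p q. p \<in> F \<and> q \<in> F \<and> p \<noteq> q \<and> p \<noteq> x1 \<and> q \<noteq> x1")
      case False
      then obtain x2 where "F \<subseteq> {x1, x2}" "x2 \<in> F" using x1 by blast
      then show ?thesis using two[of x1 x2] less.prems x1 by blast
    next
      case True
      then obtain p q where pq: "p \<in> F" "q \<in> F" "p \<noteq> q" "p \<noteq> x1" "q \<noteq> x1" by blast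
      \<comment> \<open>\<open>x1\<close> stays in \<open>F0\<close> and will be a central element
        of \<open>V\<close>.\<close>
      define F0 where "F0 = F - {p, q}"
      define V where "V = {(u, v). u \<in> X \<and> v \<in> X \<and>
        (\<exists>y. (y, u) \<in> T \<and> (y, v) \<in> T \<and> (\<forall>w\<in>F0. (y, w) \<in> T))}"
      have F0: "F0 \<subseteq> X" "x1 \<in> F0" using less.prems x1 pq unfolding F0_def by auto
      have subV: "subalg (prod_op f f) V"
      proof (rule subalg_relI)
        fix a b c d
        assume "(a, b) \<in> V" "(c, d) \<in> V"
        then obtain y y' where y: "(y, a) \<in> T" "(y, b) \<in> T" "\<forall>w\<in>F0. (y, w) \<in> T"
          and y': "(y', c) \<in> T" "(y', d) \<in> T" "\<forall>w\<in>F0. (y', w) \<in> T"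
          and X': "a \<in> X" "b \<in> X" "c \<in> X" "d \<in> X"
          unfolding V_def by blast
        have "(g y y', w) \<in> T" if "w \<in> F0" for w
        proof -
          have "(g y y', f w w) \<in> T" using subalg_relD[OF T(1)] y y' that by blast
          then show ?thesis using comm_idem_idem[OF X(3)] that F0 by auto
        qed
        moreover have "(g y y', f a c) \<in> T" "(g y y', f b d) \<in> T"
          using subalg_relD[OF T(1)] y y' by blast+
        ultimately show "(f a c, f b d) \<in> V"
          using X' X(1) unfolding V_def by (auto simp: subalg_def)
      qed
      \<comment> \<open>\<open>insert v F0\<close> has fewer than \<open>n\<close> elements for
        every \<open>v\<close> in \<open>X\<close>, not only for those in \<open>F\<close>.\<close>
      have x1V: "(x1, v) \<in> V" if "v \<in> X" for v
      proof -
        have "card F0 = card F - 2"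
          using pq finF unfolding F0_def by (simp add: card_Diff_subset)
        moreover have "card F0 > 0" using F0 finF unfolding F0_def by (auto simp: card_gt_0_iff)
        ultimately have "card F0 + 1 < n" using less.prems(2) by linarith
        moreover have "card (insert v F0) \<le> card F0 + 1"
          by (simp add: card_insert_le_m1)
        ultimately have "card (insert v F0) < n" by linarith
        from less.IH[OF this, of "insert v F0"] show ?thesis
          using that F0 unfolding V_def by auto
      qed
      have sym: "(v, u) \<in> V" if "(u, v) \<in> V" for u v
        using that unfolding V_def by auto
      have "absorbs f {u \<in> X. \<forall>v\<in>X. (u, v) \<in> V} X"
      proof (rule center_absorbs[OF subV _ X(1) X(1-4)])
        show "\<exists>b\<in>X. (a, b) \<in> V" if "a \<in> X" for a
          using sym[OF x1V[OF that]] F0 by blast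
        show "{u \<in> X. \<forall>v\<in>X. (u, v) \<in> V} \<noteq> {}"
          using x1V F0 by blast
      qed
      then have "{u \<in> X. \<forall>v\<in>X. (u, v) \<in> V} = X"
        using absorption_freeD[OF X(4)] by blast
      then have "(p, q) \<in> V" using pq less.prems by blast
      then show ?thesis unfolding V_def F0_def by blast
    qed
  qed
  from this[of X "card X"] show ?thesis using X(5) by blast
qed

section \<open>Linked relations between absorption-free algebras\<close>

lemma relpow_converse:
  fixes R :: "('a \<times> 'a) set"
  shows "(R\<inverse>) ^^ n = (R ^^ n)\<inverse>"
proof (induction n)
  case (Suc n)
  have "(R ^^ Suc n)\<inverse> = (R O R ^^ n)\<inverse>"
    by (simp add: relpow_commute)
  then show ?case using Suc by (simp add: converse_relcomp)
qed auto

lemma sym_relpow: "sym R \<Longrightarrow> sym (R ^^ n)"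
  by (simp add: sym_conv_converse_eq) (metis relpow_converse)

text \<open>Take the shortest power of \<open>S\<close> that is full and halve it. Any two elements
  have a common neighbour under the half power \<open>T\<close>, so by
  \<open>common_neighbour\<close> one element is a \<open>T\<close>-neighbour of all. The center of
  \<open>T\<close> is then nonempty and absorbs \<open>X\<close>, hence \<open>T\<close> is full,
  which contradicts minimality.\<close>

lemma linked_tolerance_full:
  assumes S: "subalg (prod_op f f) S" "S \<subseteq> X \<times> X" "sym S" "\<And>x. x \<in> X \<Longrightarrow> (x, x) \<in> S"
    and X: "subalg f X" "finite X" "comm_idem f X" "absorption_free f X"
    and linked: "X \<times> X \<subseteq> S\<^sup>+"
  shows "S = X \<times> X"
proof (cases "X = {}")
  case False
  have powX: "S ^^ Suc n \<subseteq> X \<times> X" for n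
    using S(2) by (induction n) auto
  have mono: "S ^^ Suc n \<subseteq> S ^^ Suc (n + k)" for n k
  proof (induction k)
    case (Suc k)
    have "S ^^ Suc (n + k) \<subseteq> S ^^ Suc (n + k) O S"
      using powX[of "n + k"] S(4) by (auto intro!: relcompI simp del: relpow.simps)
    then show ?case using Suc by simp
  qed simp
  have "\<exists>n. X \<times> X \<subseteq> S ^^ Suc n"
  proof -
    have "\<exists>n. Y \<subseteq> S ^^ Suc n" if "finite Y" "Y \<subseteq> X \<times> X" for Y
      using that
    proof (induction Y)
      case (insert y Y)
      obtain n where n: "Y \<subseteq> S ^^ Suc n" using insert by blast
      have "y \<in> S\<^sup>+" using linked insert by blast
      then obtain m where m: "y \<in> S ^^ Suc m"
        using trancl_power[of y S] by (auto simp del: relpow.simps dest!: gr0_implies_Suc)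
      have "S ^^ Suc n \<subseteq> S ^^ Suc (m + n)"
        using mono[of n m] by (simp only: add.commute)
      moreover have "S ^^ Suc m \<subseteq> S ^^ Suc (m + n)"
        by (rule mono)
      ultimately have "insert y Y \<subseteq> S ^^ Suc (m + n)"
        using n m by blast
      then show ?case by (rule exI)
    qed simp
    from this[of "X \<times> X"] show ?thesis using X(2) by simp
  qed
  define n where "n = (LEAST n. X \<times> X \<subseteq> S ^^ Suc n)"
  have n: "X \<times> X \<subseteq> S ^^ Suc n"
    unfolding n_def using \<open>\<exists>n. X \<times> X \<subseteq> S ^^ Suc n\<close> by (rule LeastI_ex)
  have "n = 0"
  proof (rule ccontr)
    assume "n \<noteq> 0"
    \<comment> \<open>Powers are counted from \<open>S ^^ Suc 0\<close>. Two halves of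
      \<open>k + 1\<close> steps make at least \<open>n + 1\<close> steps, reflexivity takes up the
      surplus, and still \<open>k < n\<close>.\<close>
    define k where "k = n div 2"
    have kn: "k < n" using \<open>n \<noteq> 0\<close> unfolding k_def by simp
    define T where "T = S ^^ Suc k"
    have subT: "subalg (prod_op f f) T"
      unfolding T_def by (rule subalg_relpow[OF S(1)])
    have TX: "T \<subseteq> X \<times> X" unfolding T_def by (rule powX)
    have symT: "(b, a) \<in> T" if "(a, b) \<in> T" for a b
      using symD[OF sym_relpow[OF S(3)] that[unfolded T_def]] unfolding T_def .
    have "X \<times> X \<subseteq> T O T"
    proof -
      have "S ^^ Suc n \<subseteq> S ^^ Suc (n + (2 * k + 1 - n))" by (rule mono)
      also have "Suc (n + (2 * k + 1 - n)) = Suc k + Suc k"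
        unfolding k_def by linarith
      also have "S ^^ (Suc k + Suc k) = T O T"
        unfolding T_def by (rule relpow_add)
      finally show ?thesis using n by blast
    qed
    then have "\<exists>y. (y, x) \<in> T \<and> (y, x') \<in> T" if "x \<in> X" "x' \<in> X" for x x'
      using that symT by blast
    then obtain y where y: "\<forall>x\<in>X. (y, x) \<in> T"
      using common_neighbour[OF subT TX X] False by blast
    have yX: "y \<in> X" using y TX False by blast
    have "absorbs f {u \<in> X. \<forall>v\<in>X. (u, v) \<in> T} X"
    proof (rule center_absorbs[OF subT _ X(1) X])
      show "\<exists>b\<in>X. (a, b) \<in> T" if "a \<in> X" for a
        using y yX symT that by blast
      show "{u \<in> X. \<forall>v\<in>X. (u, v) \<in> T} \<noteq> {}" using y yX by blast
    qed
    then have "X \<times> X \<subseteq> T"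
      using absorption_freeD[OF X(4)] by blast
    then have "n \<le> k" unfolding n_def T_def by (rule Least_le)
    then show False using kn by simp
  qed
  then show ?thesis using n S(2) by auto
qed (use S(2) in auto)

text \<open>\<open>W\<inverse> O W\<close> is a linked tolerance on \<open>X\<close>, hence full. So
  any two elements of \<open>X\<close> have a common neighbour in \<open>Y\<close>, then all
  elements of \<open>X\<close> have one together, and the center is nonempty.\<close>

lemma linked_imp_center:
  assumes W: "subalg (prod_op g f) W" "W \<subseteq> Y \<times> X"
    and total: "\<And>x. x \<in> X \<Longrightarrow> \<exists>y. (y, x) \<in> W" "\<And>y. y \<in> Y \<Longrightarrow> \<exists>x. (y, x) \<in> W"
    and X: "subalg f X" "finite X" "comm_idem f X" "absorption_free f X" "X \<noteq> {}"
    and Y: "subalg g Y"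
    and linked: "X \<times> X \<subseteq> (W\<inverse> O W)\<^sup>+"
  shows "absorbs g {y \<in> Y. \<forall>x\<in>X. (y, x) \<in> W} Y"
proof -
  have "W\<inverse> O W = X \<times> X"
  proof (rule linked_tolerance_full)
    show "subalg (prod_op f f) (W\<inverse> O W)"
      using W(1) by (intro subalg_relcomp subalg_converse)
    show "sym (W\<inverse> O W)" by (auto simp: sym_def)
    show "(x, x) \<in> W\<inverse> O W" if "x \<in> X" for x
      using total(1)[OF that] by blast
  qed (use W X linked in auto)
  then have "\<exists>y. (y, x) \<in> W \<and> (y, x') \<in> W" if "x \<in> X" "x' \<in> X" for x x'
    using that by blast
  then obtain y where y: "\<forall>x\<in>X. (y, x) \<in> W"
    using common_neighbour[OF W X] by blast
  show ?thesis
  proof (rule center_absorbs[OF W(1) _ Y X(1-4)])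
    show "\<exists>b\<in>X. (a, b) \<in> W" if "a \<in> Y" for a
      using total(2)[OF that] W(2) by blast
    show "{y \<in> Y. \<forall>x\<in>X. (y, x) \<in> W} \<noteq> {}"
      using y W(2) X(5) by blast
  qed
qed

text \<open>The walk from \<open>a\<close> to \<open>b\<close> goes through \<open>f a b\<close>, which lowers the level by one.\<close>

lemma absorbing_walk:
  assumes G: "absorbs (prod_op f f) G' G" "(a, b) \<in> G" "(a, a) \<in> G'" "(b, b) \<in> G'"
    and f: "comm_idem f A" "subalg f A" "G \<subseteq> A \<times> A"
  shows "(a, b) \<in> G'\<^sup>*"
proof -
  have "(a, b) \<in> G'\<^sup>*"
    if "(a, b) \<in> absorb_level (prod_op f f) G' k" "(a, a) \<in> G'" "(b, b) \<in> G'" for a b k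
    using that
  proof (induction k arbitrary: a b)
    case (Suc k)
    have AB: "a \<in> A" "b \<in> A"
      using Suc.prems(2,3) f(3) G(1) unfolding absorbs_def by auto
    have m: "(f a b, f a b) \<in> G'"
      using G(1) Suc.prems(2,3) subalg_relD unfolding absorbs_def by metis
    \<comment> \<open>The factors are the loops at \<open>a\<close> and at \<open>b\<close>. By
      commutativity the two products are \<open>(a, f a b)\<close> and
      \<open>(f a b, b)\<close>.\<close>
    have "(f a a, f a b) \<in> absorb_level (prod_op f f) G' k"
      "(f b a, f b b) \<in> absorb_level (prod_op f f) G' k"
      using Suc.prems by fastforce+
    then have "(a, f a b) \<in> absorb_level (prod_op f f) G' k"
      "(f a b, b) \<in> absorb_level (prod_op f f) G' k"
      using comm_idem_idem[OF f(1)] comm_idem_comm[OF f(1)] AB by simp_all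
    then show ?case
      using Suc.IH Suc.prems(2,3) m by (meson rtrancl_trans)
  qed auto
  then show ?thesis
    using G unfolding absorbs_def by blast
qed

subsection \<open>Powers of a finite relation\<close>

lemma relpow_mult_idem:
  assumes "R ^^ m O R ^^ m = R ^^ m"
  shows "R ^^ (m * Suc n) = R ^^ m"
proof (induction n)
  case (Suc n)
  have "R ^^ (m * Suc (Suc n)) = R ^^ (m * Suc n) O R ^^ m"
    by (simp add: relpow_add[symmetric] add.commute)
  then show ?case using Suc assms by simp
qed simp

text \<open>The powers are eventually periodic, as in any finite semigroup. Only positive exponents
  count, since \<open>R ^^ 0\<close> is the identity of the whole type.\<close>

lemma idempotent_relpow_exists:
  fixes R :: "('a \<times> 'a) set"
  assumes "finite C" "R \<subseteq> C \<times> C"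
  obtains m where "m > 0" "R ^^ m O R ^^ m = R ^^ m"
proof -
  have "R ^^ Suc n \<subseteq> C \<times> C" for n
    using assms(2) by (induction n) auto
  then have "range (\<lambda>n. R ^^ Suc n) \<subseteq> Pow (C \<times> C)"
    by (auto simp del: relpow.simps)
  then have "finite (range (\<lambda>n. R ^^ Suc n))"
    using assms(1) finite_subset by (metis finite_Pow_iff finite_cartesian_product)
  then have "\<not> inj (\<lambda>n. R ^^ Suc n)"
    using finite_imageD by blast
  then obtain p q where "R ^^ Suc p = R ^^ Suc q" "p < q"
    unfolding inj_def by (metis linorder_neqE_nat)
  define d where "d = q - p"
  have d: "d > 0" "R ^^ (Suc p + d) = R ^^ Suc p"
    using \<open>R ^^ Suc p = R ^^ Suc q\<close> \<open>p < q\<close> unfolding d_def by simp_all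
  have shift: "R ^^ (Suc p + l + d) = R ^^ (Suc p + l)" for l
  proof -
    have "R ^^ (Suc p + l + d) = R ^^ (Suc p + d) O R ^^ l"
      by (simp only: relpow_add[symmetric] add.commute add.left_commute)
    also have "\<dots> = R ^^ (Suc p + l)"
      by (subst d(2)) (rule relpow_add[symmetric])
    finally show ?thesis .
  qed
  have mult: "R ^^ (Suc p + l + d * k) = R ^^ (Suc p + l)" for k l
  proof (induction k)
    case (Suc k)
    have "R ^^ (Suc p + l + d * Suc k) = R ^^ (Suc p + (l + d * k) + d)"
      by (simp add: algebra_simps)
    also have "\<dots> = R ^^ (Suc p + (l + d * k))" by (rule shift)
    finally show ?case using Suc by (simp add: add.assoc)
  qed simp
  \<comment> \<open>A multiple of the period \<open>d\<close> that is not below the start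
    \<open>Suc p\<close> of the periodic part.\<close>
  define m where "m = Suc p * d"
  have "m \<ge> Suc p" using d(1) unfolding m_def by (cases d) auto
  then obtain l where l: "m = Suc p + l" using le_Suc_ex by blast
  have "R ^^ (m + m) = R ^^ (Suc p + l + d * Suc p)"
    using l by (simp add: m_def mult.commute)
  also have "\<dots> = R ^^ m" unfolding mult l ..
  finally show ?thesis
    using that[of m] \<open>m \<ge> Suc p\<close> by (simp add: relpow_add)
qed

text \<open>An infinite walk in a finite set returns to some point, and transitivity turns the
  return into a loop.\<close>

lemma trans_total_loop:
  assumes "finite C" "trans H" "\<And>x. x \<in> C \<Longrightarrow> \<exists>y\<in>C. (x, y) \<in> H" "x \<in> C"
  shows "\<exists>d\<in>C. (x, d) \<in> H \<and> (d, d) \<in> H"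
proof -
  obtain g where g: "\<And>x. x \<in> C \<Longrightarrow> g x \<in> C \<and> (x, g x) \<in> H"
    using assms(3) by metis
  define s where "s n = (g ^^ n) x" for n
  have sC: "s n \<in> C" for n
    unfolding s_def by (induction n) (use assms(4) g in auto)
  have step: "(s n, s (n + Suc k)) \<in> H" for n k
  proof (induction k)
    case 0
    then show ?case using g[OF sC[of n]] by (simp add: s_def)
  next
    case (Suc k)
    then show ?case
      using g[OF sC[of "n + Suc k"]] assms(2) by (auto simp: s_def dest: transD)
  qed
  have "\<not> inj (\<lambda>n. s (Suc n))"
    using sC assms(1) finite_imageD[of "\<lambda>n. s (Suc n)" UNIV] finite_subset[of "range (\<lambda>n. s (Suc n))" C]
    by auto
  then obtain p q where "s (Suc p) = s (Suc q)" "p < q"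
    unfolding inj_def by (metis linorder_neqE_nat)
  moreover have "(s (Suc p), s (Suc q)) \<in> H"
    using step[of "Suc p" "q - Suc p"] \<open>p < q\<close> by simp
  ultimately have "(s (Suc p), s (Suc p)) \<in> H" by simp
  moreover have "(x, s (Suc p)) \<in> H" using step[of 0 p] by (simp add: s_def)
  ultimately show ?thesis using sC[of "Suc p"] by blast
qed

lemma relpow_total:
  assumes "\<And>x. x \<in> C \<Longrightarrow> \<exists>y\<in>C. (x, y) \<in> R" "x \<in> C"
  shows "\<exists>y\<in>C. (x, y) \<in> R ^^ n"
proof (induction n)
  case (Suc n)
  then show ?case using assms(1) by (metis relpow_Suc_I)
qed (use assms(2) in simp)

lemma absorbs_relpow:
  assumes "absorbs (prod_op f f) K E" "E O E = E" "\<And>n. K ^^ Suc n \<noteq> {}"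
  shows "absorbs (prod_op f f) (K ^^ Suc n) E"
proof (induction n)
  case (Suc n)
  have "absorbs (prod_op f f) (K ^^ Suc n O K) (E O E)"
    using absorbs_relcomp[OF Suc assms(1)] assms(3)[of "Suc n"] by simp
  then show ?case using assms(2) by simp
qed (use assms(1) in simp)

subsection \<open>Binary constraint networks\<close>

type_synonym ('v, 'u) edge = "'v \<times> ('u \<times> 'u) set \<times> 'v"

inductive path :: "('v \<Rightarrow> 'u set) \<Rightarrow> ('v, 'u) edge set \<Rightarrow> 'v \<Rightarrow> ('u \<times> 'u) set \<Rightarrow> 'v \<Rightarrow> bool"
  for A E where
  path_refl: "path A E i (Id_on (A i)) i"
| path_step: "path A E i P j \<Longrightarrow> (j, R, k) \<in> E \<Longrightarrow> path A E i (P O R) k"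

text \<open>With the empty path as \<open>Q\<close>, every step of a closed path can be undone by
  repeating that path. With arbitrary \<open>Q\<close>, if \<open>P\<close> carries a set
  \<open>B\<close> onto \<open>D\<close> and \<open>Q\<close> carries \<open>D\<close> onto
  \<open>B\<close>, then \<open>B = D\<close>.\<close>

definition consistent :: "'v set \<Rightarrow> ('v \<Rightarrow> 'u set) \<Rightarrow> ('v, 'u) edge set \<Rightarrow> bool" where
  "consistent V A E \<longleftrightarrow> (\<forall>i\<in>V. \<forall>P Q. path A E i P i \<longrightarrow> path A E i Q i \<longrightarrow>
     (\<forall>(a, b)\<in>P. (b, a) \<in> (Q O P)\<^sup>*))"

lemma consistentD:
  "consistent V A E \<Longrightarrow> i \<in> V \<Longrightarrow> path A E i P i \<Longrightarrow> path A E i Q i \<Longrightarrow> (a, b) \<in> P \<Longrightarrow>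
    (b, a) \<in> (Q O P)\<^sup>*"
  unfolding consistent_def by blast

definition restrict_edges :: "('v \<Rightarrow> 'u set) \<Rightarrow> ('v, 'u) edge set \<Rightarrow> ('v, 'u) edge set" where
  "restrict_edges C E = {(i, R \<inter> C i \<times> C j, j) |i R j. (i, R, j) \<in> E}"

text \<open>\<open>P'\<close> is not determined by \<open>P\<close> and \<open>C\<close>, as
  intermediate points are restricted too. So the same sequence of edges is followed in both networks
  at once.\<close>

inductive path_pair :: "('v \<Rightarrow> 'u set) \<Rightarrow> ('v \<Rightarrow> 'u set) \<Rightarrow> ('v, 'u) edge set \<Rightarrow>
    'v \<Rightarrow> ('u \<times> 'u) set \<Rightarrow> ('u \<times> 'u) set \<Rightarrow> 'v \<Rightarrow> bool"
  for A C E where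
  path_pair_refl: "path_pair A C E i (Id_on (A i)) (Id_on (C i)) i"
| path_pair_step: "path_pair A C E i P P' j \<Longrightarrow> (j, R, k) \<in> E \<Longrightarrow>
    path_pair A C E i (P O R) (P' O (R \<inter> C j \<times> C k)) k"

lemma path_pair_path: "path_pair A C E i P P' j \<Longrightarrow> path A E i P j"
  by (induction rule: path_pair.induct) (auto intro: path.intros)

lemma path_pair_restrict: "path_pair A C E i P P' j \<Longrightarrow> path C (restrict_edges C E) i P' j"
  by (induction rule: path_pair.induct) (auto intro!: path.intros simp: restrict_edges_def)

lemma path_restrict_pair:
  "path C (restrict_edges C E) i P' j \<Longrightarrow> \<exists>P. path_pair A C E i P P' j"
proof (induction rule: path.induct)
  case (path_step i P j R k)
  then show ?case
    unfolding restrict_edges_def using path_pair_step by fastforce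
qed (blast intro: path_pair_refl)

text \<open>The index \<open>N\<close> is the same for all \<open>x\<close> and \<open>y\<close>.
  Thus the condition survives in powers of an algebra, where different coordinates may stabilise at
  different times.\<close>

locale spiral =
  fixes f :: "'u \<Rightarrow> 'u \<Rightarrow> 'u" and G :: "'u set" and N :: nat
  assumes comm_idem_G: "comm_idem f G"
    and closed_G: "subalg f G"
    and stable: "x \<in> G \<Longrightarrow> y \<in> G \<Longrightarrow> f x ((f x ^^ N) y) = (f x ^^ N) y"

locale network = spiral f G N
  for f :: "'u \<Rightarrow> 'u \<Rightarrow> 'u" and G N +
  fixes V :: "'v set" and A :: "'v \<Rightarrow> 'u set" and E :: "('v, 'u) edge set"
  assumes finite_V: "finite V"
    and finite_A: "i \<in> V \<Longrightarrow> finite (A i)"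
    and nonempty_A: "i \<in> V \<Longrightarrow> A i \<noteq> {}"
    and subalg_A: "i \<in> V \<Longrightarrow> subalg f (A i)"
    and A_subset: "i \<in> V \<Longrightarrow> A i \<subseteq> G"
    and edge_V: "(i, R, j) \<in> E \<Longrightarrow> i \<in> V \<and> j \<in> V"
    and edge_subset: "(i, R, j) \<in> E \<Longrightarrow> R \<subseteq> A i \<times> A j"
    and edge_subalg: "(i, R, j) \<in> E \<Longrightarrow> subalg (prod_op f f) R"
    and edge_total: "(i, R, j) \<in> E \<Longrightarrow> a \<in> A i \<Longrightarrow> \<exists>b. (a, b) \<in> R"
    and edge_converse: "(i, R, j) \<in> E \<Longrightarrow> (j, R\<inverse>, i) \<in> E"
begin

abbreviation f2 where "f2 \<equiv> prod_op f f"

lemma comm_idem_A: "i \<in> V \<Longrightarrow> comm_idem f (A i)"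
  using comm_idem_subset[OF comm_idem_G] A_subset by blast

lemma path_props:
  assumes "path A E i P j" "i \<in> V"
  shows "j \<in> V \<and> P \<subseteq> A i \<times> A j \<and> subalg f2 P \<and> (\<forall>a\<in>A i. \<exists>b. (a, b) \<in> P)"
  using assms
proof (induction rule: path.induct)
  case (path_refl i)
  then show ?case by (auto intro: subalg_Id_on subalg_A)
next
  case (path_step i P j R k)
  have "\<exists>c. (a, c) \<in> P O R" if "a \<in> A i" for a
    using path_step that edge_total[OF path_step.hyps(2)] by blast
  then show ?case
    using path_step edge_V[OF path_step.hyps(2)] edge_subset[OF path_step.hyps(2)]
      edge_subalg[OF path_step.hyps(2)]
    by (auto intro: subalg_relcomp)
qed

lemmas path_V = path_props[THEN conjunct1]
  and path_subset = path_props[THEN conjunct2, THEN conjunct1]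
  and path_subalg = path_props[THEN conjunct2, THEN conjunct2, THEN conjunct1]
  and path_total = path_props[THEN conjunct2, THEN conjunct2, THEN conjunct2, rule_format]

lemma path_append:
  "path A E j Q k \<Longrightarrow> path A E i P j \<Longrightarrow> i \<in> V \<Longrightarrow> path A E i (P O Q) k"
proof (induction rule: path.induct)
  case (path_refl j)
  then have "P O Id_on (A j) = P" using path_subset[of i P j] by auto
  then show ?case using path_refl by simp
next
  case (path_step j Q k R l)
  then show ?case by (simp add: path.path_step flip: O_assoc)
qed

lemma path_edge: "(i, R, j) \<in> E \<Longrightarrow> path A E i R j"
proof -
  assume e: "(i, R, j) \<in> E"
  then have "Id_on (A i) O R = R" using edge_subset by fastforce
  then show ?thesis using path_step[OF path_refl[of A E i] e] by simp
qed

lemma path_converse: "path A E i P j \<Longrightarrow> i \<in> V \<Longrightarrow> path A E j (P\<inverse>) i"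
proof (induction rule: path.induct)
  case (path_refl i)
  then show ?case using path.path_refl[of A E i] by simp
next
  case (path_step i P j R k)
  then have "path A E k (R\<inverse> O P\<inverse>) i"
    using path_append path_edge edge_converse edge_V by metis
  then show ?case by (simp add: converse_relcomp)
qed

lemma path_total_conv:
  assumes "path A E i P j" "i \<in> V" "b \<in> A j"
  shows "\<exists>a. (a, b) \<in> P"
  using path_total[OF path_converse[OF assms(1,2)]] path_V[OF assms(1,2)] assms(3) by auto

end

section \<open>Restricting the domains of a network\<close>

locale subnetwork = network f G N V A E
  for f :: "'u \<Rightarrow> 'u \<Rightarrow> 'u" and G N and V :: "'v set" and A E +
  fixes C :: "'v \<Rightarrow> 'u set"
  assumes C_subset: "i \<in> V \<Longrightarrow> C i \<subseteq> A i"
    and C_nonempty: "i \<in> V \<Longrightarrow> C i \<noteq> {}"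
    and C_subalg: "i \<in> V \<Longrightarrow> subalg f (C i)"
    and C_total: "(i, R, j) \<in> E \<Longrightarrow> a \<in> C i \<Longrightarrow> \<exists>b\<in>C j. (a, b) \<in> R"
begin

sublocale restricted: network f G N V C "restrict_edges C E"
proof
  fix i R j
  assume "(i, R, j) \<in> restrict_edges C E"
  then obtain R0 where R: "R = R0 \<inter> C i \<times> C j" "(i, R0, j) \<in> E"
    unfolding restrict_edges_def by blast
  show "i \<in> V \<and> j \<in> V" using edge_V[OF R(2)] .
  show "R \<subseteq> C i \<times> C j" using R by blast
  show "subalg (prod_op f f) R"
    using R edge_subalg[OF R(2)] edge_V[OF R(2)] by (simp add: subalg_Int subalg_Times C_subalg)
  show "\<exists>b. (a, b) \<in> R" if "a \<in> C i" for a
    using C_total[OF R(2) that] R(1) that by blast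
  have "R\<inverse> = R0\<inverse> \<inter> C j \<times> C i" using R(1) by blast
  then show "(j, R\<inverse>, i) \<in> restrict_edges C E"
    using edge_converse[OF R(2)] unfolding restrict_edges_def by blast
next
  fix i
  assume i: "i \<in> V"
  show "C i \<subseteq> G" using C_subset[OF i] A_subset[OF i] by blast
  show "finite (C i)" using C_subset[OF i] finite_A[OF i] finite_subset by blast
qed (use finite_V C_nonempty C_subalg in auto)

lemma path_pair_append:
  "path_pair A C E j Q Q' k \<Longrightarrow> path_pair A C E i P P' j \<Longrightarrow> i \<in> V \<Longrightarrow>
    path_pair A C E i (P O Q) (P' O Q') k"
proof (induction rule: path_pair.induct)
  case (path_pair_refl j)
  have "P O Id_on (A j) = P" "P' O Id_on (C j) = P'"
    using path_subset[OF path_pair_path[OF path_pair_refl(1)]] path_pair_refl(2)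
      restricted.path_subset[OF path_pair_restrict[OF path_pair_refl(1)]] by auto
  then show ?case using path_pair_refl by simp
next
  case (path_pair_step j Q Q' k R l)
  then show ?case by (simp add: path_pair.path_pair_step flip: O_assoc)
qed

lemma path_pair_power:
  assumes "path_pair A C E i P P' i" "i \<in> V"
  shows "path_pair A C E i (P ^^ Suc n) (P' ^^ Suc n) i"
proof (induction n)
  case (Suc n)
  then show ?case using path_pair_append[OF assms(1) Suc assms(2)] by simp
qed (use assms in simp)

lemma path_pair_subset:
  assumes "path_pair A C E i P P' j" "i \<in> V"
  shows "P' \<subseteq> P"
  using assms
proof (induction rule: path_pair.induct)
  case (path_pair_refl i)
  then show ?case using C_subset by auto
qed auto

text \<open>The closure of a closed path relation under composition is an equivalence relation on
  \<open>A i\<close>; the absorbing relation \<open>Z\<close> shows that the restricted path connects any two of its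
  equivalent elements in \<open>C i\<close>.\<close>

lemma consistent_restrict:
  assumes cons: "consistent V A E"
    and Z: "\<And>i P P'. i \<in> V \<Longrightarrow> path_pair A C E i P P' i \<Longrightarrow>
      \<exists>Z. absorbs f2 Z P \<and> Z \<inter> C i \<times> C i \<subseteq> P' \<and>
        (\<forall>a\<in>C i. \<exists>b\<in>C i. (a, b) \<in> Z) \<and> (\<forall>b\<in>C i. \<exists>a\<in>C i. (a, b) \<in> Z)"
  shows "consistent V C (restrict_edges C E)"
  unfolding consistent_def
proof (intro ballI allI impI, clarify)
  fix i P' Q' a b
  assume i: "i \<in> V" and P': "path C (restrict_edges C E) i P' i"
    and Q': "path C (restrict_edges C E) i Q' i" and ab: "(a, b) \<in> P'"
  obtain P where P: "path_pair A C E i P P' i" using path_restrict_pair[OF P'] by blast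
  obtain Q where Q: "path_pair A C E i Q Q' i" using path_restrict_pair[OF Q'] by blast
  have abC: "a \<in> C i" "b \<in> C i" using restricted.path_subset[OF P' i] ab by auto
  define H where "H = Q O P"
  define H' where "H' = Q' O P'"
  have pp: "path_pair A C E i H H' i"
    unfolding H_def H'_def by (rule path_pair_append[OF P Q i])
  note pH = path_pair_path[OF pp] and pH' = path_pair_restrict[OF pp]
  have totH: "\<exists>y\<in>A i. (x, y) \<in> H" if "x \<in> A i" for x
    using path_total[OF pH i that] path_subset[OF pH i] by blast
  have totH': "\<exists>y\<in>C i. (x, y) \<in> H'" if "x \<in> C i" for x
    using restricted.path_total[OF pH' i that] restricted.path_subset[OF pH' i] by blast
  have "(b, a) \<in> H\<^sup>*"
    unfolding H_def
    by (rule consistentD[OF cons i path_pair_path[OF P] path_pair_path[OF Q]])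
      (use ab path_pair_subset[OF P i] in blast)
  then obtain k where k: "(b, a) \<in> H ^^ k"
    using rtrancl_imp_relpow by blast
  show "(b, a) \<in> (Q' O P')\<^sup>*"
  proof (cases k)
    case 0
    then show ?thesis using k by simp
  next
    case (Suc k')
    obtain m where m: "m > 0" "H ^^ m O H ^^ m = H ^^ m"
      using idempotent_relpow_exists[OF finite_A[OF i] path_subset[OF pH i]] by blast
    \<comment> \<open>Idempotence makes \<open>T\<close> transitive, and consistency with the empty
      path makes it symmetric; as it is total, it is an equivalence relation on
      \<open>A i\<close>.\<close>
    define T where "T = H ^^ m"
    obtain m' where m': "m = Suc m'" using m(1) gr0_implies_Suc by blast
    have ppT: "path_pair A C E i T (H' ^^ m) i"
      unfolding T_def m' by (rule path_pair_power[OF pp i])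
    note pT = path_pair_path[OF ppT]
    have TT: "T O T = T" unfolding T_def by (rule m)
    have transT: "trans T" using TT by (auto intro!: transI)
    have TA: "T \<subseteq> A i \<times> A i" by (rule path_subset[OF pT i])
    have symT: "(y, x) \<in> T" if "(x, y) \<in> T" for x y
    proof -
      have "(y, x) \<in> (Id_on (A i) O T)\<^sup>*"
        by (rule consistentD[OF cons i pT path_refl that])
      moreover have "Id_on (A i) O T = T" using TA by auto
      ultimately have "(y, x) \<in> T\<^sup>*" by simp
      then have "y = x \<or> (y, x) \<in> T"
        using rtranclD trancl_id[OF transT] by fastforce
      then show ?thesis using that by auto
    qed
    have reflT: "(x, x) \<in> T" if "x \<in> A i" for x
      using path_total[OF pT i that] symT transT by (meson transD)
    \<comment> \<open>Both \<open>d'\<close> and \<open>a\<close> are reached from \<open>b\<close>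
      in \<open>k\<close> steps of \<open>H\<close>. Completing these walks to lengths divisible by
      \<open>m\<close> shows that \<open>d'\<close> and \<open>a\<close> are
      \<open>T\<close>-equivalent, while \<open>d'\<close> is reached inside the restricted
      network.\<close>
    obtain d' where d': "d' \<in> C i" "(b, d') \<in> H' ^^ k"
      using relpow_total[OF totH' abC(2)] by blast
    then have bd': "(b, d') \<in> H ^^ k"
      using path_pair_subset[OF path_pair_power[OF pp i] i] unfolding Suc by blast
    have "d' \<in> A i" using d' C_subset[OF i] by blast
    then obtain w where w: "(d', w) \<in> H ^^ (m' * k)"
      using relpow_total[OF totH] by blast
    have "(b, w) \<in> H ^^ (k + m' * k)"
      unfolding relpow_add using bd' w by blast
    also have "k + m' * k = m * Suc k'" using m' Suc by (simp add: algebra_simps)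
    also have "H ^^ (m * Suc k') = T"
      unfolding T_def by (rule relpow_mult_idem[OF m(2)])
    finally have "(w, b) \<in> H ^^ m" using symT unfolding T_def by blast
    then have "(d', a) \<in> H ^^ (m' * k + m + k)"
      unfolding relpow_add using w k by blast
    also have "m' * k + m + k = m * Suc k" using m' by (simp add: algebra_simps)
    also have "H ^^ (m * Suc k) = T"
      unfolding T_def by (rule relpow_mult_idem[OF m(2)])
    finally have d'a: "(d', a) \<in> T" .
    obtain Z where Z: "absorbs f2 Z T" "Z \<inter> C i \<times> C i \<subseteq> H' ^^ m"
      "\<forall>a\<in>C i. \<exists>b\<in>C i. (a, b) \<in> Z" "\<forall>b\<in>C i. \<exists>a\<in>C i. (a, b) \<in> Z"
      using assms(2)[OF i ppT] by blast
    define K where "K = Z \<inter> C i \<times> C i"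
    define T' where "T' = T \<inter> C i \<times> C i"
    have ZT: "Z \<subseteq> T" using Z(1) unfolding absorbs_def by blast
    have totK: "\<exists>y\<in>C i. (x, y) \<in> K" "\<exists>y\<in>C i. (y, x) \<in> K" if "x \<in> C i" for x
      using Z(3,4) that unfolding K_def by blast+
    have "absorbs f2 (Z \<inter> T') T'"
    proof (rule absorbs_Int[OF Z(1)])
      show "subalg f2 T'"
        unfolding T'_def using path_subalg[OF pT i] C_subalg[OF i]
        by (intro subalg_Int subalg_Times)
      show "Z \<inter> T' \<noteq> {}" using totK[OF abC(1)] ZT unfolding K_def T'_def by blast
    qed (auto simp: T'_def)
    moreover have "Z \<inter> T' = K" using ZT unfolding K_def T'_def by blast
    ultimately have KT': "absorbs f2 K T'" by simp
    have T'T': "T' O T' = T'"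
    proof
      show "T' O T' \<subseteq> T'" unfolding T'_def using TT by blast
      show "T' \<subseteq> T' O T'" unfolding T'_def using reflT C_subset[OF i] by blast
    qed
    have KC: "K \<subseteq> C i \<times> C i" unfolding K_def by blast
    obtain n where n: "n > 0" "K ^^ n O K ^^ n = K ^^ n"
      using idempotent_relpow_exists[OF finite_subset[OF C_subset[OF i] finite_A[OF i]] KC] by blast
    \<comment> \<open>\<open>absorbing_walk\<close> needs loops at both ends. A transitive power of
      \<open>K\<close> that is total in both directions leads from \<open>d'\<close> to a loop
      \<open>d\<close>, and from a loop \<open>e\<close> to \<open>a\<close>.\<close>
    define L where "L = K ^^ n"
    have totL: "\<exists>y\<in>C i. (x, y) \<in> L" if "x \<in> C i" for x
      unfolding L_def by (rule relpow_total[OF totK(1) that])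
    have totLc: "\<exists>y\<in>C i. (y, x) \<in> L" if "x \<in> C i" for x
    proof -
      have "\<exists>y\<in>C i. (x, y) \<in> (K\<inverse>) ^^ l" for l
        by (rule relpow_total[OF _ that]) (use totK(2) in blast)
      then show ?thesis unfolding L_def relpow_converse by blast
    qed
    have LT': "absorbs f2 L T'"
    proof -
      have "K ^^ Suc l \<noteq> {}" for l
        using relpow_total[OF totK(1) abC(1), of "Suc l"] by blast
      then show ?thesis
        using absorbs_relpow[OF KT' T'T', of "n - 1"] n(1) unfolding L_def by simp
    qed
    have transL: "trans L" using n(2) unfolding L_def by (auto intro!: transI)
    have finC: "finite (C i)" using finite_A[OF i] C_subset[OF i] finite_subset by blast
    obtain d where d: "d \<in> C i" "(d', d) \<in> L" "(d, d) \<in> L"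
      using trans_total_loop[OF finC transL totL d'(1)] by blast
    have transLc: "trans (L\<inverse>)" using transL by (auto simp: trans_def)
    obtain e where e: "e \<in> C i" "(e, a) \<in> L" "(e, e) \<in> L"
      using trans_total_loop[OF finC transLc _ abC(1)] totLc by auto
    have LT: "L \<subseteq> T" using LT' unfolding absorbs_def T'_def by blast
    have "(d, d') \<in> T" "(a, e) \<in> T" using d e LT symT by blast+
    then have "(d, e) \<in> T'"
      using d'a transT d(1) e(1) unfolding T'_def by (blast dest: transD)
    then have "(d, e) \<in> L\<^sup>*"
      using absorbing_walk[OF LT' _ d(3) e(3) comm_idem_A[OF i] subalg_A[OF i]] TA
      unfolding T'_def by blast
    then have "(d', a) \<in> L\<^sup>*"
      using d(2) e(2) by (meson converse_rtrancl_into_rtrancl rtrancl.rtrancl_into_rtrancl)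
    moreover have "L \<subseteq> H'\<^sup>*"
    proof -
      have "K \<subseteq> H'\<^sup>*" using Z(2) relpow_imp_rtrancl unfolding K_def by blast
      then have "K\<^sup>* \<subseteq> H'\<^sup>*" by (metis rtrancl_idemp rtrancl_mono)
      then show ?thesis using relpow_imp_rtrancl unfolding L_def by blast
    qed
    ultimately have "(d', a) \<in> H'\<^sup>*"
      by (metis rtrancl_idemp rtrancl_mono subsetD)
    moreover have "(b, d') \<in> H'\<^sup>*" using d'(2) relpow_imp_rtrancl by blast
    ultimately show ?thesis unfolding H'_def by (meson rtrancl_trans)
  qed
qed

end

section \<open>Absorption in binary relations\<close>

lemma absorbs_box:
  assumes R: "subalg (prod_op f g) R" "R \<subseteq> A \<times> B"
    and C: "absorbs f C A" "absorbs g D B" "R \<inter> C \<times> D \<noteq> {}"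
  shows "absorbs (prod_op f g) (R \<inter> C \<times> D) R"
proof -
  let ?S = "{r \<in> R. fst r \<in> C}"
  have 1: "absorbs (prod_op f g) ?S R"
    by (rule absorbs_vimage[OF C(1) R(1)]) (use R(2) C(3) in \<open>auto simp: prod_op_def\<close>)
  then have S: "subalg (prod_op f g) ?S" unfolding absorbs_def by blast
  have "absorbs (prod_op f g) {r \<in> ?S. snd r \<in> D} ?S"
  proof (rule absorbs_vimage[OF C(2) S])
    show "snd ` ?S \<inter> D \<noteq> {}" using C(3) by force
  qed (use R(2) in \<open>auto simp: prod_op_def\<close>)
  moreover have "{r \<in> ?S. snd r \<in> D} = R \<inter> C \<times> D" by auto
  ultimately show ?thesis using absorbs_trans[OF _ 1] by simp
qed

lemma absorbs_converse:
  assumes "absorbs (prod_op f g) Z P" "subalg (prod_op f g) P"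
  shows "absorbs (prod_op g f) (Z\<inverse>) (P\<inverse>)"
proof -
  have "absorbs (prod_op g f) (prod.swap ` Z) (prod.swap ` P)"
    by (rule absorbs_image[OF assms]) (auto simp: prod_op_def)
  moreover have "prod.swap ` Y = Y\<inverse>" for Y :: "('a \<times> 'b) set" by force
  ultimately show ?thesis by simp
qed

lemma absorbs_fst_total:
  assumes Z: "absorbs (prod_op f g) Z P" and P: "subalg (prod_op f g) P" "fst ` P = A"
    and A: "absorption_free f A" "a \<in> A"
  shows "\<exists>b. (a, b) \<in> Z"
proof -
  have "absorbs f (fst ` Z) (fst ` P)"
    by (rule absorbs_image[OF Z P(1)]) (auto simp: prod_op_def)
  then have "fst ` Z = A" using absorption_freeD[OF A(1)] P(2) by simp
  then show ?thesis using A(2) by force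
qed

text \<open>Choose a point that reaches as few points as possible; whatever it reaches has the same
  set of reachable points.\<close>

lemma finite_sink_exists:
  assumes "finite X" "st \<subseteq> X \<times> X" "x0 \<in> X"
  obtains x where "x \<in> X" "\<And>y. (x, y) \<in> st\<^sup>* \<Longrightarrow> (y, x) \<in> st\<^sup>*"
proof -
  obtain x where x: "x \<in> X" "\<And>y. y \<in> X \<Longrightarrow> card (st\<^sup>* `` {x}) \<le> card (st\<^sup>* `` {y})"
    using ex_min_if_finite[of "(\<lambda>x. card (st\<^sup>* `` {x})) ` X"] assms(1,3)
    by (auto simp: not_less)
  have reach: "st\<^sup>* `` {y} \<subseteq> insert y X" for y
    using assms(2) by (auto elim: rtranclE)
  show ?thesis
  proof (rule that[OF x(1)])
    fix y
    assume y: "(x, y) \<in> st\<^sup>*"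
    then have "y \<in> X" using reach[of x] x(1) by blast
    have "st\<^sup>* `` {y} \<subseteq> st\<^sup>* `` {x}" using y by (auto intro: rtrancl_trans)
    moreover have "finite (st\<^sup>* `` {x})" using reach assms(1) finite_subset by blast
    ultimately have "st\<^sup>* `` {y} = st\<^sup>* `` {x}"
      using x(2)[OF \<open>y \<in> X\<close>] by (meson card_seteq)
    then show "(y, x) \<in> st\<^sup>*" by blast
  qed
qed

subsection \<open>Reduction to absorbing subalgebras\<close>

context subnetwork
begin

lemma path_pair_absorbs:
  assumes "path_pair A C E i P P' j" "i \<in> V" "\<And>i. i \<in> V \<Longrightarrow> absorbs f (C i) (A i)"
  shows "absorbs f2 P' P"
  using assms(1,2)
proof (induction rule: path_pair.induct)
  case (path_pair_refl i)
  have "absorbs f2 ((\<lambda>x. (x, x)) ` C i) ((\<lambda>x. (x, x)) ` A i)"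
    by (rule absorbs_image) (use assms(3) path_pair_refl subalg_A in auto)
  moreover have "(\<lambda>x. (x, x)) ` D = Id_on D" for D :: "'u set" by auto
  ultimately show ?case by simp
next
  case (path_pair_step i P P' j R k)
  note e = path_pair_step.hyps(2)
  have pp: "path_pair A C E i (P O R) (P' O (R \<inter> C j \<times> C k)) k"
    using path_pair_step.hyps by (rule path_pair.path_pair_step)
  have ne: "R \<inter> C j \<times> C k \<noteq> {}"
    using C_nonempty C_total[OF e] edge_V[OF e] by blast
  have "absorbs f2 (R \<inter> C j \<times> C k) R"
    using absorbs_box[OF edge_subalg[OF e] edge_subset[OF e]] ne assms(3) edge_V[OF e] by blast
  moreover have "P' O (R \<inter> C j \<times> C k) \<noteq> {}"
    using restricted.path_total[OF path_pair_restrict[OF pp]] path_pair_step.prems C_nonempty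
    by blast
  ultimately show ?case
    using path_pair_step absorbs_relcomp by blast
qed

text \<open>The set \<open>Z\<close> of \<open>consistent_restrict\<close> is \<open>P'\<close>
  itself: restricted path relations absorb the original ones.\<close>

lemma consistent_absorbing:
  assumes "consistent V A E" "\<And>i. i \<in> V \<Longrightarrow> absorbs f (C i) (A i)"
  shows "consistent V C (restrict_edges C E)"
proof (rule consistent_restrict[OF assms(1)])
  fix i P P'
  assume i: "i \<in> V" and pp: "path_pair A C E i P P' i"
  note p' = path_pair_restrict[OF pp]
  have "\<exists>b\<in>C i. (a, b) \<in> P'" if "a \<in> C i" for a
    using restricted.path_total[OF p' i that] restricted.path_subset[OF p' i] by blast
  moreover have "\<exists>b\<in>C i. (b, a) \<in> P'" if "a \<in> C i" for a
    using restricted.path_total_conv[OF p' i that] restricted.path_subset[OF p' i] by blast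
  ultimately show "\<exists>Z. absorbs f2 Z P \<and> Z \<inter> C i \<times> C i \<subseteq> P' \<and>
      (\<forall>a\<in>C i. \<exists>b\<in>C i. (a, b) \<in> Z) \<and> (\<forall>b\<in>C i. \<exists>a\<in>C i. (a, b) \<in> Z)"
    using path_pair_absorbs[OF pp i assms(2)] by blast
qed

end

context network
begin

lemma edge_image_absorbs:
  assumes e: "(i, R, j) \<in> E" and B: "absorbs f B (A i)"
  shows "absorbs f (R `` B) (A j)"
proof -
  have "absorbs f2 {r \<in> R. fst r \<in> B} R"
  proof (rule absorbs_vimage[OF B edge_subalg[OF e]])
    show "fst ` R \<inter> B \<noteq> {}"
      using B edge_total[OF e] unfolding absorbs_def by force
  qed (use edge_subset[OF e] in \<open>auto simp: prod_op_def\<close>)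
  then have "absorbs f (snd ` {r \<in> R. fst r \<in> B}) (snd ` R)"
    by (rule absorbs_image[OF _ edge_subalg[OF e]]) (auto simp: prod_op_def)
  moreover have "snd ` {r \<in> R. fst r \<in> B} = R `` B" by force
  moreover have "snd ` R = A j"
    using edge_subset[OF e] edge_total[OF edge_converse[OF e]] by force
  ultimately show ?thesis by simp
qed

text \<open>Proper absorbing subalgebras are pushed along edges until a strongly connected sink is
  reached. By consistency such a sink contains at most one subalgebra of each \<open>A i\<close>.\<close>

lemma absorbing_reduction:
  assumes cons: "consistent V A E" and i0: "i0 \<in> V" "\<not> absorption_free f (A i0)"
  obtains C where "subnetwork f G N V A E C" "consistent V C (restrict_edges C E)"
    "\<exists>i\<in>V. C i \<noteq> A i"
proof -
  define X where "X = {(i, B). i \<in> V \<and> absorbs f B (A i) \<and> B \<noteq> A i}"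
  \<comment> \<open>The intersection with \<open>X \<times> X\<close> drops the pushes whose image
    is a whole domain.\<close>
  define st where "st = {((i, B), (j, R `` B)) |i B R j. (i, R, j) \<in> E} \<inter> X \<times> X"
  have "X \<subseteq> Sigma V (\<lambda>i. Pow (A i))"
    unfolding X_def absorbs_def by auto
  then have finX: "finite X"
    using finite_V finite_A by (meson finite_Pow_iff finite_SigmaI finite_subset)
  obtain B0 where "(i0, B0) \<in> X"
    using i0 unfolding absorption_free_def X_def by blast
  then obtain x where x: "x \<in> X" "\<And>y. (x, y) \<in> st\<^sup>* \<Longrightarrow> (y, x) \<in> st\<^sup>*"
    using finite_sink_exists[OF finX, of st] unfolding st_def by blast
  define S where "S = st\<^sup>* `` {x}"
  have SX: "S \<subseteq> X"
    using x(1) unfolding S_def st_def by (auto elim: rtranclE)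
  have reach: "(y, z) \<in> st\<^sup>*" if "y \<in> S" "z \<in> S" for y z
    using that x(2) unfolding S_def by (meson Image_singleton_iff rtrancl_trans)
  have walk: "\<exists>P. path A E (fst y) P (fst z) \<and> snd z = P `` snd y"
    if "(y, z) \<in> st\<^sup>*" "y \<in> X" for y z
    using that
  proof (induction rule: rtrancl_induct)
    case base
    have "Id_on (A (fst y)) `` snd y = snd y"
      using base unfolding X_def absorbs_def by auto
    then show ?case using path_refl by metis
  next
    case (step z w)
    then obtain P where P: "path A E (fst y) P (fst z)" "snd z = P `` snd y" by blast
    obtain R where R: "(fst z, R, fst w) \<in> E" "snd w = R `` snd z"
      using step.hyps(2) unfolding st_def by auto
    show ?case
      using path_step[OF P(1) R(1)] P(2) R(2) by (metis relcomp_Image)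
  qed
  \<comment> \<open>Two subalgebras at one node of the sink are carried onto each other by closed
    paths \<open>P\<close> and \<open>Q\<close>. Consistency returns from a point of
    \<open>D\<close> to \<open>a\<close> by steps of \<open>Q O P\<close>, under which
    \<open>D\<close> is closed.\<close>
  have uniq_le: "B \<subseteq> D" if B: "(i, B) \<in> S" and D: "(i, D) \<in> S" for i B D
  proof
    fix a
    assume a: "a \<in> B"
    have i: "i \<in> V" "B \<subseteq> A i" using B SX unfolding X_def absorbs_def by auto
    obtain P where P: "path A E i P i" "D = P `` B"
      using walk[OF reach[OF B D]] B SX by auto
    obtain Q where Q: "path A E i Q i" "B = Q `` D"
      using walk[OF reach[OF D B]] D SX by auto
    obtain b where b: "(a, b) \<in> P" using path_total[OF P(1) i(1)] a i(2) by blast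
    have "(b, a) \<in> (Q O P)\<^sup>*" by (rule consistentD[OF cons i(1) P(1) Q(1) b])
    moreover have "b \<in> D" using b a P(2) by blast
    moreover have "(Q O P) `` D \<subseteq> D" using P(2) Q(2) by blast
    ultimately show "a \<in> D" by (metis Image_closed_trancl ImageI)
  qed
  define C where "C j = (if \<exists>D. (j, D) \<in> S then SOME D. (j, D) \<in> S else A j)" for j
  have C_S: "C j = D" if "(j, D) \<in> S" for j D
  proof -
    have "(j, C j) \<in> S" using that unfolding C_def by (auto intro: someI)
    then show ?thesis using uniq_le that by blast
  qed
  have C_A: "C j = A j" if "\<not> (\<exists>D. (j, D) \<in> S)" for j
    using that unfolding C_def by simp
  have absC: "absorbs f (C j) (A j)" if "j \<in> V" for j
  proof (cases "\<exists>D. (j, D) \<in> S")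
    case True
    then show ?thesis using C_S SX unfolding X_def by fastforce
  next
    case False
    then show ?thesis using C_A absorbs_refl[OF subalg_A nonempty_A] that by simp
  qed
  \<comment> \<open>The image of \<open>C j\<close> is all of \<open>A k\<close>, or it is proper
    and then belongs to the sink, where it equals \<open>C k\<close> by uniqueness. If no subalgebra
    at \<open>j\<close> is in the sink, \<open>C j\<close> is the whole domain.\<close>
  have push: "C k \<subseteq> R `` C j" if e: "(j, R, k) \<in> E" for j R k
  proof (cases "R `` C j = A k")
    case True
    then show ?thesis using absC edge_V[OF e] unfolding absorbs_def by blast
  next
    case False
    show ?thesis
    proof (cases "\<exists>D. (j, D) \<in> S")
      case True
      then have S: "(j, C j) \<in> S" using C_S by blast
      have "(k, R `` C j) \<in> X"
        using edge_image_absorbs[OF e] absC edge_V[OF e] False unfolding X_def by blast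
      then have "((j, C j), (k, R `` C j)) \<in> st"
        using S SX e unfolding st_def by blast
      then have "(k, R `` C j) \<in> S" using S unfolding S_def by (auto intro: rtrancl_into_rtrancl)
      then show ?thesis using C_S by blast
    next
      case no: False
      have "A k \<subseteq> R `` A j"
        using edge_total[OF edge_converse[OF e]] edge_subset[OF e] by blast
      then show ?thesis using C_A[OF no] absC edge_V[OF e] unfolding absorbs_def by blast
    qed
  qed
  have sub: "subnetwork f G N V A E C"
  proof
    fix i R j a
    assume e: "(i, R, j) \<in> E" and a: "a \<in> C i"
    show "\<exists>b\<in>C j. (a, b) \<in> R" using push[OF edge_converse[OF e]] a by blast
  qed (use absC in \<open>auto simp: absorbs_def\<close>)
  moreover have "consistent V C (restrict_edges C E)"
    using subnetwork.consistent_absorbing[OF sub cons absC] .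
  moreover obtain i B where "x = (i, B)" by force
  then have "i \<in> V" "C i \<noteq> A i"
    using x(1) C_S[of i B] unfolding S_def X_def by auto
  ultimately show thesis using that by blast
qed

end

subsection \<open>Congruences\<close>

definition congruence :: "('u \<Rightarrow> 'u \<Rightarrow> 'u) \<Rightarrow> 'u set \<Rightarrow> ('u \<times> 'u) set \<Rightarrow> bool" where
  "congruence f X \<theta> \<longleftrightarrow> \<theta> \<subseteq> X \<times> X \<and> (\<forall>x\<in>X. (x, x) \<in> \<theta>) \<and> sym \<theta> \<and> trans \<theta> \<and>
     subalg (prod_op f f) \<theta>"

lemma maximal_congruence_exists:
  assumes "finite X" "subalg f X" "a \<in> X" "b \<in> X" "a \<noteq> b"
  obtains \<theta> where "congruence f X \<theta>" "\<theta> \<noteq> X \<times> X"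
    "\<And>\<theta>'. congruence f X \<theta>' \<Longrightarrow> \<theta> \<subseteq> \<theta>' \<Longrightarrow> \<theta>' = \<theta> \<or> \<theta>' = X \<times> X"
proof -
  let ?S = "{\<theta>. congruence f X \<theta> \<and> \<theta> \<noteq> X \<times> X}"
  have "?S \<subseteq> Pow (X \<times> X)" unfolding congruence_def by blast
  then have "finite ?S" using assms(1) by (meson finite_Pow_iff finite_SigmaI finite_subset)
  moreover have "congruence f X (Id_on X)"
    using subalg_Id_on[OF assms(2)] unfolding congruence_def by (auto simp: sym_def trans_def)
  then have "Id_on X \<in> ?S" using assms(3-5) by auto
  ultimately obtain \<theta> where "\<theta> \<in> ?S" "\<forall>\<theta>'\<in>?S. \<theta> \<subseteq> \<theta>' \<longrightarrow> \<theta> = \<theta>'"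
    using finite_has_maximal[of ?S] by blast
  then show thesis using that[of \<theta>] by blast
qed

locale simple_quotient = spiral f G N
  for f :: "'u \<Rightarrow> 'u \<Rightarrow> 'u" and G N +
  fixes X :: "'u set" and \<theta> :: "('u \<times> 'u) set"
  assumes finite_X: "finite X" and X_subset: "X \<subseteq> G" and subalg_X: "subalg f X"
    and free_X: "absorption_free f X" and nonempty_X: "X \<noteq> {}"
    and congr: "congruence f X \<theta>" and proper: "\<theta> \<noteq> X \<times> X"
    and maximal: "congruence f X \<theta>' \<Longrightarrow> \<theta> \<subseteq> \<theta>' \<Longrightarrow> \<theta>' = \<theta> \<or> \<theta>' = X \<times> X"
begin

lemma theta_X: "(x, y) \<in> \<theta> \<Longrightarrow> x \<in> X \<and> y \<in> X"
  and theta_refl: "x \<in> X \<Longrightarrow> (x, x) \<in> \<theta>"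
  and theta_sym: "(x, y) \<in> \<theta> \<Longrightarrow> (y, x) \<in> \<theta>"
  and theta_trans: "(x, y) \<in> \<theta> \<Longrightarrow> (y, z) \<in> \<theta> \<Longrightarrow> (x, z) \<in> \<theta>"
  and theta_op: "(x, y) \<in> \<theta> \<Longrightarrow> (x', y') \<in> \<theta> \<Longrightarrow> (f x x', f y y') \<in> \<theta>"
  using congr unfolding congruence_def by (auto dest: symD transD subalg_relD)

lemma comm_idem_X: "comm_idem f X"
  using comm_idem_subset[OF comm_idem_G X_subset] .

text \<open>The quotient of \<open>X\<close> by \<theta> is never formed. Saturated relations to
  \<open>X\<close> stand for relations to the quotient, and \<open>functional\<close> says that such
  a relation is a partial map into it.\<close>

definition saturated :: "('v \<times> 'u) set \<Rightarrow> bool" where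
  "saturated W \<longleftrightarrow> (\<forall>y x x'. (y, x) \<in> W \<longrightarrow> (x, x') \<in> \<theta> \<longrightarrow> (y, x') \<in> W)"

definition functional :: "('v \<times> 'u) set \<Rightarrow> bool" where
  "functional W \<longleftrightarrow> (\<forall>y x x'. (y, x) \<in> W \<longrightarrow> (y, x') \<in> W \<longrightarrow> (x, x') \<in> \<theta>)"

text \<open>The transitive closure of \<open>W\<inverse> O W\<close> is a congruence that contains
  \<theta>. By maximality it is \<theta>, and then \<open>W\<close> is functional, or it is
  full.\<close>

lemma functional_or_linked:
  assumes W: "subalg (prod_op g f) W" "W \<subseteq> Y \<times> X" "\<And>x. x \<in> X \<Longrightarrow> \<exists>y. (y, x) \<in> W"
    and sat: "saturated W"
  shows "functional W \<or> X \<times> X \<subseteq> (W\<inverse> O W)\<^sup>+"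
proof -
  let ?L = "(W\<inverse> O W)\<^sup>+"
  have refl: "(x, x) \<in> W\<inverse> O W" if "x \<in> X" for x
    using W(3)[OF that] by blast
  have subX: "W\<inverse> O W \<subseteq> X \<times> X" using W(2) by blast
  have sub: "subalg (prod_op f f) (W\<inverse> O W)"
    using W(1) by (intro subalg_relcomp subalg_converse)
  have "sym (W\<inverse> O W)" by (auto simp: sym_def)
  then have "congruence f X ?L"
    using refl trancl_subset_Sigma[OF subX] subalg_trancl[OF sub refl subX]
    unfolding congruence_def by (auto intro: sym_trancl)
  moreover have "\<theta> \<subseteq> W\<inverse> O W"
  proof clarify
    fix x x'
    assume x: "(x, x') \<in> \<theta>"
    then obtain y where y: "(y, x) \<in> W" using W(3) theta_X by blast
    then have "(y, x') \<in> W" using sat x unfolding saturated_def by blast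
    then show "(x, x') \<in> W\<inverse> O W" using y by blast
  qed
  ultimately have "?L = \<theta> \<or> ?L = X \<times> X"
    using maximal[of ?L] by blast
  then show ?thesis
    unfolding functional_def by blast
qed

text \<open>Multiply \<open>z\<close> by \<open>y\<close> repeatedly. If the stable value
  \<open>s N\<close> is outside the class of \<open>y\<close>, then \<open>y, s N\<close> is an
  edge. Otherwise the last value before the class of \<open>y\<close> is entered, followed by
  \<open>y\<close>, is one.\<close>

lemma nontrivial_edge:
  obtains x x' where "x \<in> X" "x' \<in> X" "(x, x') \<notin> \<theta>" "(f x x', x') \<in> \<theta>"
proof -
  obtain y z where yz: "y \<in> X" "z \<in> X" "(y, z) \<notin> \<theta>"
    using proper congr unfolding congruence_def by blast
  define s where "s k = (f y ^^ k) z" for k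
  have sX: "s k \<in> X" for k
    unfolding s_def by (induction k) (use yz subalg_X in \<open>auto simp: subalg_def\<close>)
  show thesis
  proof (cases "(y, s N) \<in> \<theta>")
    case False
    have "f y (s N) = s N" unfolding s_def using stable yz X_subset by blast
    then show thesis using that[of y "s N"] False yz(1) sX theta_refl by auto
  next
    case True
    define k where "k = (LEAST k. (y, s k) \<in> \<theta>)"
    have k: "(y, s k) \<in> \<theta>" unfolding k_def using True by (rule LeastI)
    then have "k \<noteq> 0" using yz(3) by (auto simp: s_def intro: ccontr)
    then obtain l where l: "k = Suc l" using not0_implies_Suc by blast
    have nl: "(y, s l) \<notin> \<theta>" using not_less_Least[of l "\<lambda>k. (y, s k) \<in> \<theta>"] l k_def by auto
    have "f (s l) y = s k"
      using comm_idem_comm[OF comm_idem_X sX yz(1)] unfolding l s_def by simp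
    then show thesis using that[of "s l" y] nl k sX yz(1) theta_sym by auto
  qed
qed

text \<open>In an affine algebra the graph of an operation \<open>B \<times> D \<rightarrow> X\<close> could satisfy these hypotheses.
  Here an edge of \<open>X\<close> lifts to an edge \<open>d, d'\<close> of \<open>D\<close>, and computing the product of
  \<open>(b, d)\<close> and \<open>(b, d')\<close> with some \<open>(b', d')\<close> yields two different values at one pair.\<close>

lemma not_functional:
  assumes W: "subalg (prod_op (prod_op f f) f) W" "W \<subseteq> (B \<times> D) \<times> X"
    and BD: "B \<subseteq> G" "D \<subseteq> G" "B \<noteq> {}"
    and sat: "saturated W"
    and B: "\<And>b x. b \<in> B \<Longrightarrow> x \<in> X \<Longrightarrow> \<exists>d. ((b, d), x) \<in> W"
    and D: "\<And>d x. d \<in> D \<Longrightarrow> x \<in> X \<Longrightarrow> \<exists>b. ((b, d), x) \<in> W"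
  shows "\<not> functional W"
proof
  assume fn: "functional W"
  have op: "((f b b', f d d'), f x x') \<in> W" if "((b, d), x) \<in> W" "((b', d'), x') \<in> W"
    for b b' d d' x x'
    using subalg_relD[OF W(1) that] by simp
  obtain x x' where x: "x \<in> X" "x' \<in> X" "(x, x') \<notin> \<theta>" "(f x x', x') \<in> \<theta>"
    by (rule nontrivial_edge)
  obtain b where b: "b \<in> B" using BD(3) by blast
  obtain d d1 where d: "((b, d), x) \<in> W" "((b, d1), x') \<in> W"
    using B[OF b] x by blast
  have dD: "d \<in> D" "d1 \<in> D" using d W(2) by auto
  define d' where "d' = (f d ^^ N) d1"
  have bb: "f b b = b" using b BD(1) comm_idem_idem[OF comm_idem_G] by blast
  have "((b, (f d ^^ n) d1), (f x ^^ n) x') \<in> W \<and> ((f x ^^ n) x', x') \<in> \<theta>" for n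
  proof (induction n)
    case 0
    then show ?case using d x theta_refl by simp
  next
    case (Suc n)
    have "((b, f d ((f d ^^ n) d1)), f x ((f x ^^ n) x')) \<in> W"
      using op[OF d(1) conjunct1[OF Suc]] bb by simp
    moreover have "(f x ((f x ^^ n) x'), f x x') \<in> \<theta>"
      using theta_op theta_refl[OF x(1)] Suc by blast
    ultimately show ?case using x(4) theta_trans by auto
  qed
  from this[of N] have bd': "((b, d'), x') \<in> W"
    using sat unfolding saturated_def d'_def by blast
  then have d'D: "d' \<in> D" using W(2) by blast
  then obtain b2 where b2: "((b2, d'), x) \<in> W" using D x(1) by blast
  have dd': "f d d' = d'" unfolding d'_def using stable dD BD(2) by blast
  have "d \<in> G" "d' \<in> G" using dD d'D BD(2) by blast+
  then have d'd: "f d' d = d'"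
    using comm_idem_comm[OF comm_idem_G, of d d'] dd' by simp
  have "f d' d' = d'" "f x x = x"
    using comm_idem_idem[OF comm_idem_G] d'D BD(2) x(1) X_subset by blast+
  \<comment> \<open>Since \<open>f d' d = d' = f d' d'\<close>, both products sit at the pair
    \<open>(f b2 b, d')\<close>, but their values are \<open>x\<close> and \<open>f x x'\<close>,
    which is equivalent to \<open>x'\<close>.\<close>
  then have "((f b2 b, d'), x) \<in> W" "((f b2 b, d'), f x x') \<in> W"
    using op[OF b2 d(1)] op[OF b2 bd'] d'd by simp_all
  then have "(x, f x x') \<in> \<theta>" using fn unfolding functional_def by blast
  then show False using x(3,4) theta_trans by blast
qed

end

subsection \<open>Reduction to a congruence class\<close>

locale free_network = network f G N V A E
  for f :: "'u \<Rightarrow> 'u \<Rightarrow> 'u" and G N and V :: "'v set" and A E +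
  fixes i0 :: 'v and \<theta> :: "('u \<times> 'u) set"
  assumes cons: "consistent V A E" and free: "i \<in> V \<Longrightarrow> absorption_free f (A i)"
    and i0: "i0 \<in> V"
    and congr0: "congruence f (A i0) \<theta>" and proper0: "\<theta> \<noteq> A i0 \<times> A i0"
    and maximal0: "\<And>\<theta>'. congruence f (A i0) \<theta>' \<Longrightarrow> \<theta> \<subseteq> \<theta>' \<Longrightarrow> \<theta>' = \<theta> \<or> \<theta>' = A i0 \<times> A i0"
begin

sublocale simple_quotient f G N "A i0" \<theta>
  by standard
    (use i0 finite_A A_subset subalg_A free nonempty_A congr0 proper0 maximal0 in auto)

section \<open>Functional paths to \<open>i0\<close>\<close>

lemma path_fst: "path A E i P j \<Longrightarrow> i \<in> V \<Longrightarrow> fst ` P = A i"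
  using path_total[of i P j] path_subset[of i P j] by force

lemma absorbing_total:
  assumes "path A E i P j" "i \<in> V" "absorbs f2 Z P"
  shows "a \<in> A i \<Longrightarrow> \<exists>b. (a, b) \<in> Z" and "b \<in> A j \<Longrightarrow> \<exists>a. (a, b) \<in> Z"
proof -
  show "\<exists>b. (a, b) \<in> Z" if "a \<in> A i" for a
    using absorbs_fst_total[OF assms(3) path_subalg path_fst free that] assms by blast
  note j = path_V[OF assms(1,2)] and p = path_converse[OF assms(1,2)]
  have "absorbs f2 (Z\<inverse>) (P\<inverse>)"
    using absorbs_converse[OF assms(3) path_subalg[OF assms(1,2)]] .
  then have "\<exists>a. (b, a) \<in> Z\<inverse>" if "b \<in> A j" for b
    using absorbs_fst_total[OF _ path_subalg[OF p j] path_fst[OF p j] free[OF j] that] by blast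
  then show "\<exists>a. (a, b) \<in> Z" if "b \<in> A j" for b using that by blast
qed

lemma path_theta:
  assumes "path A E j P i0" "j \<in> V"
  shows "subalg f2 (P O \<theta>)" "P O \<theta> \<subseteq> A j \<times> A i0" "saturated (P O \<theta>)"
    "x \<in> A i0 \<Longrightarrow> \<exists>b. (b, x) \<in> P O \<theta>" "b \<in> A j \<Longrightarrow> \<exists>x. (b, x) \<in> P O \<theta>"
proof -
  show "subalg f2 (P O \<theta>)"
    using subalg_relcomp[OF path_subalg[OF assms]] congr0 unfolding congruence_def by blast
  show "P O \<theta> \<subseteq> A j \<times> A i0"
    using path_subset[OF assms] theta_X by blast
  show "saturated (P O \<theta>)"
    unfolding saturated_def using theta_trans by blast
  show "\<exists>b. (b, x) \<in> P O \<theta>" if "x \<in> A i0" for x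
    using path_total_conv[OF assms that] theta_refl[OF that] by blast
  show "\<exists>x. (b, x) \<in> P O \<theta>" if "b \<in> A j" for b
    using path_total[OF assms that] path_subset[OF assms] theta_refl by blast
qed

text \<open>A relation that is not functional is linked, so its center absorbs \<open>A j\<close>
  and is therefore all of \<open>A j\<close>.\<close>

lemma functional_or_full:
  assumes "path A E j P i0" "j \<in> V"
  shows "functional (P O \<theta>) \<or> A j \<times> A i0 \<subseteq> P O \<theta>"
proof (cases "functional (P O \<theta>)")
  case False
  note W = path_theta[OF assms]
  have "A i0 \<times> A i0 \<subseteq> ((P O \<theta>)\<inverse> O (P O \<theta>))\<^sup>+"
    using functional_or_linked[OF W(1,2,4,3)] False by blast
  then have "absorbs f {b \<in> A j. \<forall>x\<in>A i0. (b, x) \<in> P O \<theta>} (A j)"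
    using linked_imp_center[OF W(1,2,4,5) subalg_X finite_X comm_idem_X free_X nonempty_X
        subalg_A[OF assms(2)]] by blast
  then have "{b \<in> A j. \<forall>x\<in>A i0. (b, x) \<in> P O \<theta>} = A j"
    using absorption_freeD free assms(2) by blast
  then show ?thesis by blast
qed simp

text \<open>All functional paths from \<open>j\<close> to \<open>i0\<close> induce the same map. The
  closed path \<open>R\<close> sends \<open>b\<close> to some \<open>b'\<close> whose class under
  \<open>Q\<close> is that of \<open>b\<close> under \<open>P\<close>. Consistency leads back from
  \<open>b'\<close> to \<open>b\<close> by steps of \<open>R\<inverse> O R\<close>, which preserve
  the class under \<open>Q\<close> because \<open>P\<close> and \<open>Q\<close> are
  functional.\<close>

lemma functional_unique_le:
  assumes P: "path A E j P i0" "functional (P O \<theta>)" and Q: "path A E j Q i0" "functional (Q O \<theta>)"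
    and j: "j \<in> V"
  shows "P O \<theta> \<subseteq> Q O \<theta>"
proof clarify
  fix b v x
  assume bv: "(b, v) \<in> P" "(v, x) \<in> \<theta>"
  define R where "R = P O Q\<inverse>"
  have pR: "path A E j R j"
    unfolding R_def using path_append[OF path_converse[OF Q(1) j] P(1) j] .
  have pRc: "path A E j (R\<inverse>) j" by (rule path_converse[OF pR j])
  have Pthet: "(u, v) \<in> P O \<theta>" if "(u, v) \<in> P" for u v
    using that path_subset[OF P(1) j] theta_refl by blast
  have Qthet: "(u, v) \<in> Q O \<theta>" if "(u, v) \<in> Q" for u v
    using that path_subset[OF Q(1) j] theta_refl by blast
  obtain b' where b': "(b', v) \<in> Q"
    using path_total_conv[OF Q(1) j] path_subset[OF P(1) j] bv(1) by blast
  have "(b, b') \<in> R" unfolding R_def using bv b' by blast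
  then have "(b', b) \<in> (R\<inverse> O R)\<^sup>*" by (rule consistentD[OF cons j pR pRc])
  then have "(b, x) \<in> Q O \<theta>"
  proof (induction rule: rtrancl_induct)
    case base
    then show ?case using b' bv(2) by blast
  next
    case (step y z)
    then obtain u v1 v2 where u: "(u, v1) \<in> P" "(y, v1) \<in> Q" "(u, v2) \<in> P" "(z, v2) \<in> Q"
      unfolding R_def by blast
    have "(v1, v2) \<in> \<theta>" using P(2) Pthet u unfolding functional_def by blast
    moreover have "(v1, x) \<in> \<theta>" using Q(2) Qthet[OF u(2)] step.IH unfolding functional_def by blast
    ultimately show ?case using u(4) theta_sym theta_trans by blast
  qed
  then show "(b, x) \<in> Q O \<theta>" .
qed

definition J :: "'v set" where
  "J = {j \<in> V. \<exists>P. path A E j P i0 \<and> functional (P O \<theta>)}"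

text \<open>For \<open>j\<close> in \<open>J\<close> this is the graph of a surjection from
  \<open>A j\<close> to the quotient of \<open>A i0\<close> by \<theta>; \<open>Phi_eq\<close> shows
  that the choice of the path does not matter.\<close>

definition \<Phi> :: "'v \<Rightarrow> ('u \<times> 'u) set" where
  "\<Phi> j = (SOME P. path A E j P i0 \<and> functional (P O \<theta>)) O \<theta>"

lemma J_path:
  assumes "j \<in> J"
  obtains P where "path A E j P i0" "functional (P O \<theta>)" "\<Phi> j = P O \<theta>" "j \<in> V"
proof -
  let ?P = "SOME P. path A E j P i0 \<and> functional (P O \<theta>)"
  have "\<exists>P. path A E j P i0 \<and> functional (P O \<theta>)"
    using assms unfolding J_def by blast
  then have "path A E j ?P i0 \<and> functional (?P O \<theta>)"
    by (rule someI_ex)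
  then show thesis using that[of ?P] assms by (simp add: \<Phi>_def J_def)
qed

lemma Phi_eq:
  assumes "path A E j P i0" "functional (P O \<theta>)" "j \<in> V"
  shows "j \<in> J" "\<Phi> j = P O \<theta>"
proof -
  show "j \<in> J" using assms unfolding J_def by blast
  then obtain Q where Q: "path A E j Q i0" "functional (Q O \<theta>)" "\<Phi> j = Q O \<theta>"
    using J_path by metis
  show "\<Phi> j = P O \<theta>"
    unfolding Q(3) using functional_unique_le[OF assms(1,2) Q(1,2) assms(3)]
      functional_unique_le[OF Q(1,2) assms] by blast
qed

lemma Phi_props:
  assumes "j \<in> J"
  shows "j \<in> V" "subalg f2 (\<Phi> j)" "\<Phi> j \<subseteq> A j \<times> A i0" "saturated (\<Phi> j)" "functional (\<Phi> j)"
    "x \<in> A i0 \<Longrightarrow> \<exists>b. (b, x) \<in> \<Phi> j" "b \<in> A j \<Longrightarrow> \<exists>x. (b, x) \<in> \<Phi> j"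
proof -
  obtain P where P: "path A E j P i0" "functional (P O \<theta>)" "\<Phi> j = P O \<theta>" and j: "j \<in> V"
    by (rule J_path[OF assms])
  show "j \<in> V" by (rule j)
  show "subalg f2 (\<Phi> j)" "\<Phi> j \<subseteq> A j \<times> A i0" "saturated (\<Phi> j)" "functional (\<Phi> j)"
    "x \<in> A i0 \<Longrightarrow> \<exists>b. (b, x) \<in> \<Phi> j" "b \<in> A j \<Longrightarrow> \<exists>x. (b, x) \<in> \<Phi> j"
    unfolding P(3) by (fact P(2) path_theta[OF P(1) j])+
qed

lemma Phi_i0: "i0 \<in> J" "\<Phi> i0 = \<theta>"
proof -
  have "Id_on (A i0) O \<theta> = \<theta>" by (auto dest: theta_X)
  moreover have "functional \<theta>"
    unfolding functional_def using theta_sym theta_trans by blast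
  ultimately show "i0 \<in> J" "\<Phi> i0 = \<theta>"
    using Phi_eq[OF path_refl _ i0] by simp_all
qed

section \<open>Rigid and loose paths\<close>

definition rigid :: "'v \<Rightarrow> ('u \<times> 'u) set \<Rightarrow> 'v \<Rightarrow> bool" where
  "rigid j R k \<longleftrightarrow> j \<in> J \<and> k \<in> J \<and> (\<forall>(b, c)\<in>R. \<forall>x. (b, x) \<in> \<Phi> j \<longleftrightarrow> (c, x) \<in> \<Phi> k)"

text \<open>Every class at \<open>k\<close> is within reach of every \<open>b\<close>. At a node
  outside \<open>J\<close> there is no class to prescribe.\<close>

definition free_right :: "'v \<Rightarrow> ('u \<times> 'u) set \<Rightarrow> 'v \<Rightarrow> bool" where
  "free_right j R k \<longleftrightarrow> (k \<in> J \<longrightarrow> (\<forall>b\<in>A j. \<forall>x\<in>A i0. \<exists>c. (b, c) \<in> R \<and> (c, x) \<in> \<Phi> k))"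

definition loose :: "'v \<Rightarrow> ('u \<times> 'u) set \<Rightarrow> 'v \<Rightarrow> bool" where
  "loose j R k \<longleftrightarrow> free_right j R k \<and> free_right k (R\<inverse>) j"

lemma rigidD:
  "rigid j R k \<Longrightarrow> j \<in> J \<and> k \<in> J"
  "rigid j R k \<Longrightarrow> (b, c) \<in> R \<Longrightarrow> (b, x) \<in> \<Phi> j \<longleftrightarrow> (c, x) \<in> \<Phi> k"
  unfolding rigid_def by auto

lemma rigid_converse: "rigid j R k \<Longrightarrow> rigid k (R\<inverse>) j"
  unfolding rigid_def by auto

text \<open>Prolong \<open>R\<close> by a functional path from \<open>k\<close> to
  \<open>i0\<close>. If the result is functional, it induces \<open>\<Phi> j\<close>, as this does
  not depend on the path, so \<open>R\<close> preserves classes. If it is full, \<open>R\<close>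
  reaches every class.\<close>

lemma rigid_or_free_right:
  assumes "path A E j R k" "j \<in> V"
  shows "rigid j R k \<or> free_right j R k"
proof (cases "k \<in> J")
  case True
  then obtain P where P: "path A E k P i0" "functional (P O \<theta>)" "\<Phi> k = P O \<theta>" "k \<in> V"
    by (rule J_path)
  have p: "path A E j (R O P) i0" by (rule path_append[OF P(1) assms])
  have eq: "(R O P) O \<theta> = R O \<Phi> k" unfolding P(3) by (rule O_assoc)
  from functional_or_full[OF p assms(2)] show ?thesis
  proof
    assume "functional ((R O P) O \<theta>)"
    from Phi_eq[OF p this assms(2)] have j: "j \<in> J" "\<Phi> j = R O \<Phi> k" unfolding eq by auto
    have "(b, x) \<in> \<Phi> j \<longleftrightarrow> (c, x) \<in> \<Phi> k" if bc: "(b, c) \<in> R" for b c x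
    proof
      assume bx: "(b, x) \<in> \<Phi> j"
      have "c \<in> A k" using path_subset[OF assms] bc by blast
      then obtain x' where x': "(c, x') \<in> \<Phi> k" using Phi_props(7)[OF True] by blast
      then have "(b, x') \<in> \<Phi> j" unfolding j(2) using bc by blast
      then have "(x', x) \<in> \<theta>" using Phi_props(5)[OF j(1)] bx unfolding functional_def by blast
      then show "(c, x) \<in> \<Phi> k" using Phi_props(4)[OF True] x' unfolding saturated_def by blast
    qed (use bc j(2) in blast)
    then show ?thesis using j(1) True unfolding rigid_def by blast
  next
    assume "A j \<times> A i0 \<subseteq> (R O P) O \<theta>"
    then show ?thesis unfolding eq free_right_def by blast
  qed
qed (simp add: free_right_def)

lemma rigid_or_loose:
  assumes "path A E j R k" "j \<in> V"
  shows "rigid j R k \<or> loose j R k"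
  using rigid_or_free_right[OF assms] rigid_or_free_right[OF path_converse[OF assms] path_V[OF assms]]
    rigid_converse[of k "R\<inverse>" j] unfolding loose_def by auto

text \<open>\<open>Z O \<Phi> k\<close> absorbs \<open>P O \<Phi> k\<close>, which is the product
  \<open>A j \<times> A i0\<close> of absorption-free algebras; hence both are equal.\<close>

lemma free_right_absorbing:
  assumes fr: "free_right j P k" and Z: "absorbs f2 Z P" and P: "path A E j P k" "j \<in> V"
  shows "free_right j Z k"
proof (cases "k \<in> J")
  case True
  note Phi = Phi_props[OF True]
  have "Z O \<Phi> k \<noteq> {}"
    using Z Phi(7) path_subset[OF P] unfolding absorbs_def by fast
  then have "absorbs f2 (Z O \<Phi> k) (P O \<Phi> k)"
    using Phi(6) nonempty_X by (intro absorbs_relcomp[OF Z] absorbs_refl[OF Phi(2)]) blast+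
  moreover have "P O \<Phi> k = A j \<times> A i0"
    using fr True Phi(3) path_subset[OF P] unfolding free_right_def by blast
  ultimately have "Z O \<Phi> k = A j \<times> A i0"
    using absorption_freeD[OF absorption_free_Times] free[OF P(2)] subalg_A[OF P(2)]
      comm_idem_A[OF P(2)] free_X subalg_X by metis
  then show ?thesis unfolding free_right_def by blast
qed (simp add: free_right_def)

lemma loose_absorbing:
  assumes "loose j P k" "absorbs f2 Z P" "path A E j P k" "j \<in> V"
  shows "loose j Z k"
  unfolding loose_def
proof
  show "free_right j Z k"
    using assms free_right_absorbing unfolding loose_def by blast
  show "free_right k (Z\<inverse>) j"
    using assms(1) free_right_absorbing[OF _ absorbs_converse[OF assms(2) path_subalg[OF assms(3,4)]]
        path_converse[OF assms(3,4)] path_V[OF assms(3,4)]]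
    unfolding loose_def by blast
qed

lemma free_right_append:
  assumes "free_right k R l" "path A E j P k" "j \<in> V"
  shows "free_right j (P O R) l"
proof -
  have "\<exists>c. (b, c) \<in> P O R \<and> (c, x) \<in> \<Phi> l" if l: "l \<in> J" "b \<in> A j" "x \<in> A i0" for b x
  proof -
    obtain a where a: "(b, a) \<in> P" "a \<in> A k"
      using path_total[OF assms(2,3) l(2)] path_subset[OF assms(2,3)] by blast
    then show ?thesis using assms(1) l unfolding free_right_def by blast
  qed
  then show ?thesis unfolding free_right_def by blast
qed

lemma free_right_rigid:
  assumes "free_right j P k" "rigid k R l" "path A E k R l" "k \<in> V"
  shows "free_right j (P O R) l"
proof -
  have k: "k \<in> J" using rigidD(1)[OF assms(2)] by (rule conjunct1)
  have "\<exists>c. (b, c) \<in> P O R \<and> (c, x) \<in> \<Phi> l" if bx: "b \<in> A j" "x \<in> A i0" for b x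
  proof -
    obtain a where a: "(b, a) \<in> P" "(a, x) \<in> \<Phi> k"
      using assms(1) k bx unfolding free_right_def by blast
    have "a \<in> A k" using a(2) Phi_props(3)[OF k] by blast
    then obtain c where c: "(a, c) \<in> R" using path_total[OF assms(3,4)] by blast
    then show ?thesis using a rigidD(2)[OF assms(2) c, of x] by blast
  qed
  then show ?thesis unfolding free_right_def by blast
qed

text \<open>Between two loose paths that meet in a node of \<open>J\<close>, the class at that node can be chosen
  freely for the pairs of end points in an absorbing set.\<close>

lemma loose_center:
  assumes P: "path A E j P k" "j \<in> V" and Z: "absorbs f2 Z P" "free_right j Z k"
    and R: "(k, R, l) \<in> E" "free_right l (R\<inverse>) k" and k: "k \<in> J"
  shows "absorbs f2 {(b, c) \<in> Z O R. \<forall>x\<in>A i0. \<exists>a. (b, a) \<in> Z \<and> (a, c) \<in> R \<and> (a, x) \<in> \<Phi> k} (Z O R)"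
proof -
  note kV = path_V[OF P] and lV = edge_V[OF R(1), THEN conjunct2]
  \<comment> \<open>\<open>W\<close> relates a pair of end points to the classes at \<open>k\<close>
    in which a middle point can be chosen.\<close>
  define W where "W = {((b, c), x). \<exists>a. (b, a) \<in> Z \<and> (a, c) \<in> R \<and> (a, x) \<in> \<Phi> k}"
  note Phi = Phi_props[OF k]
  have ZP: "Z \<subseteq> A j \<times> A k" "subalg f2 Z" using Z(1) path_subset[OF P] unfolding absorbs_def by auto
  note RA = edge_subset[OF R(1)]
  have subW: "subalg (prod_op f2 f) W"
  proof (rule subalg_relI)
    fix p x q y
    assume "(p, x) \<in> W" "(q, y) \<in> W"
    then obtain b c a b' c' a' where 1:
      "p = (b, c)" "(b, a) \<in> Z" "(a, c) \<in> R" "(a, x) \<in> \<Phi> k"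
      "q = (b', c')" "(b', a') \<in> Z" "(a', c') \<in> R" "(a', y) \<in> \<Phi> k"
      unfolding W_def by blast
    have "(f b b', f a a') \<in> Z" "(f a a', f c c') \<in> R" "(f a a', f x y) \<in> \<Phi> k"
      by (rule subalg_relD[OF ZP(2) 1(2,6)] subalg_relD[OF edge_subalg[OF R(1)] 1(3,7)]
          subalg_relD[OF Phi(2) 1(4,8)])+
    then show "(f2 p q, f x y) \<in> W"
      unfolding W_def 1(1,5) by auto
  qed
  have satW: "saturated W"
    using Phi(4) unfolding saturated_def W_def by blast
  have WB: "\<exists>c. ((b, c), x) \<in> W" if bx: "b \<in> A j" "x \<in> A i0" for b x
  proof -
    obtain a where a: "(b, a) \<in> Z" "(a, x) \<in> \<Phi> k"
      using Z(2) k bx unfolding free_right_def by blast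
    then show ?thesis using edge_total[OF R(1), of a] ZP(1) unfolding W_def by blast
  qed
  have WD: "\<exists>b. ((b, c), x) \<in> W" if cx: "c \<in> A l" "x \<in> A i0" for c x
  proof -
    obtain a where a: "(a, c) \<in> R" "(a, x) \<in> \<Phi> k"
      using R(2) k cx unfolding free_right_def by blast
    then show ?thesis
      using absorbing_total(2)[OF P Z(1), of a] RA unfolding W_def by blast
  qed
  have "W \<subseteq> (A j \<times> A l) \<times> A i0" using ZP(1) RA Phi(3) unfolding W_def by blast
  then have "\<not> functional W"
    using not_functional[OF subW _ A_subset[OF P(2)] A_subset[OF lV] nonempty_A[OF P(2)] satW WB WD]
    by blast
  moreover have W: "W \<subseteq> (Z O R) \<times> A i0" using Phi(3) unfolding W_def by blast
  moreover have Wx: "\<exists>p. (p, x) \<in> W" if "x \<in> A i0" for x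
    using WB[OF _ that] nonempty_A[OF P(2)] by blast
  ultimately have "A i0 \<times> A i0 \<subseteq> (W\<inverse> O W)\<^sup>+"
    using functional_or_linked[OF subW W Wx satW] by blast
  moreover have "\<exists>x. (p, x) \<in> W" if "p \<in> Z O R" for p
    using that Phi(7) RA unfolding W_def by blast
  ultimately have "absorbs f2 {p \<in> Z O R. \<forall>x\<in>A i0. (p, x) \<in> W} (Z O R)"
    using linked_imp_center[OF subW W Wx _ subalg_X finite_X comm_idem_X free_X nonempty_X
        subalg_relcomp[OF ZP(2) edge_subalg[OF R(1)]]] by blast
  moreover have "{p \<in> Z O R. \<forall>x\<in>A i0. (p, x) \<in> W} =
      {(b, c) \<in> Z O R. \<forall>x\<in>A i0. \<exists>a. (b, a) \<in> Z \<and> (a, c) \<in> R \<and> (a, x) \<in> \<Phi> k}"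
    unfolding W_def by auto
  ultimately show ?thesis by simp
qed

section \<open>Restriction to one class\<close>

definition class_at :: "'u \<Rightarrow> 'v \<Rightarrow> 'u set" where
  "class_at s j = (if j \<in> J then {b \<in> A j. (b, s) \<in> \<Phi> j} else A j)"

context
  fixes s
  assumes s: "s \<in> A i0"
begin

lemma class_subset: "class_at s j \<subseteq> A j"
  unfolding class_at_def by auto

lemma rigid_class: "rigid j R k \<Longrightarrow> R \<subseteq> A j \<times> A k \<Longrightarrow> (b, c) \<in> R \<Longrightarrow>
    b \<in> class_at s j \<longleftrightarrow> c \<in> class_at s k"
  using rigidD[of j R k] unfolding class_at_def by auto

lemma free_right_class:
  assumes "free_right j R k" "R \<subseteq> A j \<times> A k" "b \<in> A j" "\<exists>c. (b, c) \<in> R"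
  shows "\<exists>c\<in>class_at s k. (b, c) \<in> R"
proof (cases "k \<in> J")
  case True
  then obtain c where "(b, c) \<in> R" "(c, s) \<in> \<Phi> k"
    using assms(1,3) s unfolding free_right_def by blast
  then show ?thesis using True assms(2) unfolding class_at_def by auto
next
  case False
  then show ?thesis using assms(2,4) unfolding class_at_def by auto
qed

lemma class_total:
  assumes R: "path A E j R k" "j \<in> V" and b: "b \<in> class_at s j"
  shows "\<exists>c\<in>class_at s k. (b, c) \<in> R"
proof -
  have bA: "b \<in> A j" using b class_subset by blast
  then obtain c where c: "(b, c) \<in> R" using path_total[OF R] by blast
  from rigid_or_loose[OF R] show ?thesis
  proof
    assume "rigid j R k"
    then show ?thesis using rigid_class[OF _ path_subset[OF R] c] b c by blast
  next
    assume "loose j R k"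
    then show ?thesis
      using free_right_class[OF _ path_subset[OF R] bA] c unfolding loose_def by blast
  qed
qed

lemma class_subnetwork: "subnetwork f G N V A E (class_at s)"
proof
  fix i
  assume i: "i \<in> V"
  show "class_at s i \<noteq> {}"
    using Phi_props(3)[of i] Phi_props(6)[of i s] s nonempty_A[OF i] unfolding class_at_def by auto
  have "f b b' \<in> class_at s i" if "b \<in> class_at s i" "b' \<in> class_at s i" for b b'
  proof (cases "i \<in> J")
    case True
    then have "(f b b', f s s) \<in> \<Phi> i"
      using subalg_relD[OF Phi_props(2)[OF True]] that unfolding class_at_def by auto
    then show ?thesis
      using comm_idem_idem[OF comm_idem_X s] Phi_props(3)[OF True] True unfolding class_at_def by auto
  next
    case False
    then show ?thesis using that subalg_A[OF i] unfolding class_at_def subalg_def by simp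
  qed
  then show "subalg f (class_at s i)" unfolding subalg_def by blast
next
  fix i R j a
  assume "(i, R, j) \<in> E" "a \<in> class_at s i"
  then show "\<exists>b\<in>class_at s j. (a, b) \<in> R"
    using class_total path_edge edge_V by blast
qed (rule class_subset)

text \<open>If one of the two adjoining parts is rigid, a middle point between end points in their
  classes lies in its own class automatically. If both are loose and the middle node is in
  \<open>J\<close>, the absorbing set shrinks to the pairs provided by
  \<open>loose_center\<close>.\<close>

lemma class_path_pair:
  assumes "path_pair A (class_at s) E j P P' k" "j \<in> V"
  shows "rigid j P k \<and> P \<inter> class_at s j \<times> class_at s k \<subseteq> P' \<or>
    loose j P k \<and> (\<exists>Z. absorbs f2 Z P \<and> Z \<inter> class_at s j \<times> class_at s k \<subseteq> P')"
  using assms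
proof (induction rule: path_pair.induct)
  case (path_pair_refl j)
  have p: "path A E j (Id_on (A j)) j" by (rule path_refl)
  have "absorbs f2 (Id_on (A j)) (Id_on (A j))"
    using path_subalg[OF p] nonempty_A path_pair_refl by (intro absorbs_refl) auto
  moreover have "Id_on (A j) \<inter> class_at s j \<times> class_at s j \<subseteq> Id_on (class_at s j)" by auto
  ultimately show ?case using rigid_or_loose[OF p path_pair_refl] by blast
next
  case (path_pair_step j P P' k R l)
  note j = path_pair_step.prems and e = path_pair_step.hyps(2)
  note P = path_pair_path[OF path_pair_step.hyps(1)]
  note kV = path_V[OF P j] and R = path_edge[OF e] and RA = edge_subset[OF e]
  have PR: "path A E j (P O R) l" using path_step[OF P e] .
  let ?C = "class_at s"
  let ?R = "R \<inter> ?C k \<times> ?C l"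
  have refl: "absorbs f2 R R"
    using edge_subalg[OF e] edge_total[OF e] nonempty_A[OF kV] by (intro absorbs_refl) auto
  have comp: "absorbs f2 (Z O R) (P O R)" if Z: "absorbs f2 Z P" for Z
  proof (rule absorbs_relcomp[OF Z refl])
    show "Z O R \<noteq> {}"
      using Z path_subset[OF P j] edge_total[OF e] unfolding absorbs_def by fast
  qed
  from path_pair_step.IH[OF j] rigid_or_loose[OF R kV]
  consider (rr) "rigid j P k" "P \<inter> ?C j \<times> ?C k \<subseteq> P'" "rigid k R l"
    | (rl) "rigid j P k" "P \<inter> ?C j \<times> ?C k \<subseteq> P'" "loose k R l"
    | (lr) Z where "loose j P k" "absorbs f2 Z P" "Z \<inter> ?C j \<times> ?C k \<subseteq> P'" "rigid k R l"
    | (ll) Z where "loose j P k" "absorbs f2 Z P" "Z \<inter> ?C j \<times> ?C k \<subseteq> P'" "loose k R l"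
    by blast
  then show ?case
  proof cases
    case rr
    have "rigid j (P O R) l"
      using rr(1,3) unfolding rigid_def by fast
    moreover have "P O R \<inter> ?C j \<times> ?C l \<subseteq> P' O ?R"
      using rr(2) rigid_class[OF rr(1) path_subset[OF P j]] by blast
    ultimately show ?thesis by blast
  next
    case rl
    have "free_right j (P O R) l"
      using rl(3) free_right_append[OF _ P j] unfolding loose_def by blast
    moreover have "free_right l (R\<inverse> O P\<inverse>) j"
      using free_right_rigid[OF _ rigid_converse[OF rl(1)] path_converse[OF P j] kV] rl(3)
      unfolding loose_def by blast
    ultimately have "loose j (P O R) l"
      unfolding loose_def by (simp add: converse_relcomp)
    moreover have "P O R \<inter> ?C j \<times> ?C l \<subseteq> P' O ?R"
      using rl(2) rigid_class[OF rl(1) path_subset[OF P j]] by blast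
    moreover have "absorbs f2 P P"
      using path_subalg[OF P j] path_total[OF P j] nonempty_A[OF j] by (intro absorbs_refl) auto
    ultimately show ?thesis using comp by blast
  next
    case lr
    have "free_right j (P O R) l"
      using lr(1) free_right_rigid[OF _ lr(4) R kV] unfolding loose_def by blast
    moreover have "free_right l (R\<inverse> O P\<inverse>) j"
      using free_right_append[OF _ path_converse[OF R kV] path_V[OF R kV]] lr(1)
      unfolding loose_def by blast
    ultimately have "loose j (P O R) l"
      unfolding loose_def by (simp add: converse_relcomp)
    moreover have "Z O R \<inter> ?C j \<times> ?C l \<subseteq> P' O ?R"
      using lr(3) rigid_class[OF lr(4) RA] by blast
    ultimately show ?thesis using comp[OF lr(2)] by blast
  next
    case ll
    have "free_right j (P O R) l"
      using ll(4) free_right_append[OF _ P j] unfolding loose_def by blast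
    moreover have "free_right l (R\<inverse> O P\<inverse>) j"
      using free_right_append[OF _ path_converse[OF R kV] path_V[OF R kV]] ll(1)
      unfolding loose_def by blast
    ultimately have loose: "loose j (P O R) l"
      unfolding loose_def by (simp add: converse_relcomp)
    have "\<exists>Z'. absorbs f2 Z' (P O R) \<and> Z' \<inter> ?C j \<times> ?C l \<subseteq> P' O ?R"
    proof (cases "k \<in> J")
      case False
      then have "?C k = A k" unfolding class_at_def by simp
      then have "Z O R \<inter> ?C j \<times> ?C l \<subseteq> P' O ?R"
        using ll(3) RA by blast
      then show ?thesis using comp[OF ll(2)] by blast
    next
      case True
      let ?Z = "{(b, c) \<in> Z O R. \<forall>x\<in>A i0. \<exists>a. (b, a) \<in> Z \<and> (a, c) \<in> R \<and> (a, x) \<in> \<Phi> k}"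
      have "absorbs f2 ?Z (Z O R)"
        using loose_center[OF P j ll(2) _ e _ True] loose_absorbing[OF ll(1,2) P j] ll(4)
        unfolding loose_def by blast
      then have "absorbs f2 ?Z (P O R)" using comp[OF ll(2)] absorbs_trans by blast
      moreover have "?Z \<inter> ?C j \<times> ?C l \<subseteq> P' O ?R"
      proof clarify
        fix b c
        assume bc: "b \<in> ?C j" "c \<in> ?C l"
          and "\<forall>x\<in>A i0. \<exists>a. (b, a) \<in> Z \<and> (a, c) \<in> R \<and> (a, x) \<in> \<Phi> k"
        then obtain a where a: "(b, a) \<in> Z" "(a, c) \<in> R" "(a, s) \<in> \<Phi> k" using s by blast
        then have "a \<in> ?C k" using True Phi_props(3)[OF True] unfolding class_at_def by auto
        then show "(b, c) \<in> P' O ?R" using a bc ll(3) by blast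
      qed
      ultimately show ?thesis by blast
    qed
    then show ?thesis using loose by blast
  qed
qed

lemma class_consistent: "consistent V (class_at s) (restrict_edges (class_at s) E)"
proof (rule subnetwork.consistent_restrict[OF class_subnetwork cons])
  fix i P P'
  assume i: "i \<in> V" and pp: "path_pair A (class_at s) E i P P' i"
  note P = path_pair_path[OF pp]
  let ?C = "class_at s"
  from class_path_pair[OF pp i]
  obtain Z where Z: "absorbs f2 Z P" "Z \<inter> ?C i \<times> ?C i \<subseteq> P'" "rigid i Z i \<or> loose i Z i"
  proof
    assume "rigid i P i \<and> P \<inter> ?C i \<times> ?C i \<subseteq> P'"
    moreover have "absorbs f2 P P"
      using path_subalg[OF P i] path_total[OF P i] nonempty_A[OF i] by (intro absorbs_refl) auto
    ultimately show thesis using that by blast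
  next
    assume "loose i P i \<and> (\<exists>Z. absorbs f2 Z P \<and> Z \<inter> ?C i \<times> ?C i \<subseteq> P')"
    then show thesis using that loose_absorbing[OF _ _ P i] by blast
  qed
  have ZA: "Z \<subseteq> A i \<times> A i" using Z(1) path_subset[OF P i] unfolding absorbs_def by blast
  have "\<exists>b\<in>?C i. (a, b) \<in> Z \<and> (\<exists>b\<in>?C i. (b, a) \<in> Z)" if a: "a \<in> ?C i" for a
  proof -
    have aA: "a \<in> A i" using a class_subset by blast
    note tot = absorbing_total[OF P i Z(1) aA]
    from Z(3) show ?thesis
    proof
      assume "rigid i Z i"
      then show ?thesis using tot rigid_class[OF _ ZA] a by meson
    next
      assume "loose i Z i"
      then have "\<exists>b\<in>?C i. (a, b) \<in> Z" "\<exists>b\<in>?C i. (a, b) \<in> Z\<inverse>"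
        using tot free_right_class[OF _ ZA aA] free_right_class[of i "Z\<inverse>" i a] ZA aA
        unfolding loose_def by blast+
      then show ?thesis by blast
    qed
  qed
  then show "\<exists>Z. absorbs f2 Z P \<and> Z \<inter> ?C i \<times> ?C i \<subseteq> P' \<and>
      (\<forall>a\<in>?C i. \<exists>b\<in>?C i. (a, b) \<in> Z) \<and> (\<forall>b\<in>?C i. \<exists>a\<in>?C i. (a, b) \<in> Z)"
    using Z(1,2) by blast
qed

lemma class_proper: "class_at s i0 \<noteq> A i0"
proof
  assume eq: "class_at s i0 = A i0"
  have "(b, s) \<in> \<theta>" if "b \<in> A i0" for b
  proof -
    have "b \<in> class_at s i0" using that eq by simp
    then show ?thesis using Phi_i0 unfolding class_at_def by simp
  qed
  then have "A i0 \<times> A i0 \<subseteq> \<theta>" using theta_sym theta_trans by blast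
  then show False using proper0 congr0 unfolding congruence_def by blast
qed

end

end

section \<open>Solvability by induction on the size of the domains\<close>

theorem network_solution:
  assumes "network f G N V A E" "consistent V A E"
  shows "\<exists>v. (\<forall>i\<in>V. v i \<in> A i) \<and> (\<forall>(i, R, j)\<in>E. (v i, v j) \<in> R)"
  using assms
proof (induction "\<Sum>i\<in>V. card (A i)" arbitrary: A E rule: less_induct)
  case less
  interpret network f G N V A E by (rule less.prems(1))
  show ?case
  proof (cases "\<forall>i\<in>V. \<exists>a. A i = {a}")
    case True
    define v where "v i = (SOME a. A i = {a})" for i
    have v: "A i = {v i}" if "i \<in> V" for i
      unfolding v_def using True that by (auto intro: someI_ex)
    \<comment> \<open>A total relation between singletons contains the only possible pair.\<close>
    have "(v i, v j) \<in> R" if e: "(i, R, j) \<in> E" for i R j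
      using edge_total[OF e, of "v i"] edge_subset[OF e] edge_V[OF e] v by auto
    then show ?thesis using v by blast
  next
    case False
    obtain C where C: "subnetwork f G N V A E C" "consistent V C (restrict_edges C E)"
      "\<exists>i\<in>V. C i \<noteq> A i"
    proof (cases "\<forall>i\<in>V. absorption_free f (A i)")
      case False
      then show thesis using that absorbing_reduction[OF less.prems(2)] by blast
    next
      case free: True
      obtain i0 where i0: "i0 \<in> V" "\<not> (\<exists>a. A i0 = {a})" using False by blast
      obtain a b where ab: "a \<in> A i0" "b \<in> A i0" "a \<noteq> b"
        using i0 nonempty_A[OF i0(1)] by blast
      obtain \<theta> where th: "congruence f (A i0) \<theta>" "\<theta> \<noteq> A i0 \<times> A i0"
        "\<And>\<theta>'. congruence f (A i0) \<theta>' \<Longrightarrow> \<theta> \<subseteq> \<theta>' \<Longrightarrow> \<theta>' = \<theta> \<or> \<theta>' = A i0 \<times> A i0"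
        using maximal_congruence_exists[OF finite_A[OF i0(1)] subalg_A[OF i0(1)] ab] by blast
      interpret free_network f G N V A E i0 \<theta>
        by standard (use less.prems(2) free i0(1) th in auto)
      show thesis
        using that class_subnetwork[OF ab(1)] class_consistent[OF ab(1)] class_proper[OF ab(1)] i0(1)
        by blast
    qed
    interpret sub: subnetwork f G N V A E C by (rule C(1))
    have "(\<Sum>i\<in>V. card (C i)) < (\<Sum>i\<in>V. card (A i))"
    proof (rule sum_strict_mono_ex1[OF finite_V])
      show "\<forall>i\<in>V. card (C i) \<le> card (A i)"
        using sub.C_subset finite_A card_mono by blast
      obtain i where i: "i \<in> V" "C i \<subset> A i" using C(3) sub.C_subset by blast
      then show "\<exists>i\<in>V. card (C i) < card (A i)"
        using psubset_card_mono[OF finite_A[OF i(1)] i(2)] by blast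
    qed
    from less.hyps[OF this sub.restricted.network_axioms C(2)]
    obtain v where v: "\<forall>i\<in>V. v i \<in> C i" "\<forall>(i, R, j)\<in>restrict_edges C E. (v i, v j) \<in> R"
      by blast
    have "(v i, v j) \<in> R" if "(i, R, j) \<in> E" for i R j
    proof -
      have "(i, R \<inter> C i \<times> C j, j) \<in> restrict_edges C E"
        unfolding restrict_edges_def using that by blast
      from bspec[OF v(2) this] show ?thesis by simp
    qed
    then show ?thesis using v(1) sub.C_subset by blast
  qed
qed

subsection \<open>Terms and generated subalgebras\<close>

inductive_set generated :: "('b \<Rightarrow> 'b \<Rightarrow> 'b) \<Rightarrow> 'b set \<Rightarrow> 'b set" for f B where
  generated_base: "b \<in> B \<Longrightarrow> b \<in> generated f B"
| generated_op: "x \<in> generated f B \<Longrightarrow> y \<in> generated f B \<Longrightarrow> f x y \<in> generated f B"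

lemma generated_image:
  assumes "\<And>x y. h (f x y) = g (h x) (h y)"
  shows "h ` generated f B = generated g (h ` B)"
proof
  have "h x \<in> generated g (h ` B)" if "x \<in> generated f B" for x
    using that by induction (auto simp: assms intro: generated.intros)
  then show "h ` generated f B \<subseteq> generated g (h ` B)" by blast
  have "y \<in> h ` generated f B" if "y \<in> generated g (h ` B)" for y
    using that
  proof induction
    case (generated_op x y)
    then obtain x' y' where "x = h x'" "y = h y'" "x' \<in> generated f B" "y' \<in> generated f B"
      by blast
    then show ?case using assms generated.generated_op by (metis image_eqI)
  qed (auto intro: generated_base)
  then show "generated g (h ` B) \<subseteq> h ` generated f B" by blast
qed

lemma generated_mono:
  assumes "B \<subseteq> C"
  shows "generated f B \<subseteq> generated f C"
proof
  fix x
  assume "x \<in> generated f B"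
  then show "x \<in> generated f C"
    by induction (use assms in \<open>auto intro: generated.intros\<close>)
qed

lemma subalg_generated: "subalg f (generated f B)"
  by (simp add: subalg_def generated_op)

lemma generated_minimal:
  assumes "B \<subseteq> C" "subalg f C"
  shows "generated f B \<subseteq> C"
proof
  fix x
  assume "x \<in> generated f B"
  then show "x \<in> C"
    by induction (use assms in \<open>auto simp: subalg_def\<close>)
qed

primrec rename :: "(nat \<Rightarrow> nat) \<Rightarrow> bterm \<Rightarrow> bterm" where
  "rename \<rho> (Var i) = Var (\<rho> i)"
| "rename \<rho> (Op s t) = Op (rename \<rho> s) (rename \<rho> t)"

lemma tvars_rename: "tvars (rename \<rho> t) = \<rho> ` tvars t"
  by (induction t) auto

lemma teval_rename: "teval f v (rename \<rho> t) = teval f (\<lambda>i. v (\<rho> i)) t"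
  by (induction t) auto

lemma teval_cong: "(\<And>i. i \<in> tvars t \<Longrightarrow> v i = w i) \<Longrightarrow> teval f v t = teval f w t"
  by (induction t) auto

subsection \<open>The network of a weak spiral\<close>

locale finite_weak_spiral =
  fixes A :: "'a set" and f :: "'a \<Rightarrow> 'a \<Rightarrow> 'a" and c0 :: 'a
  assumes finite_A: "finite A" and weak_spiral: "weak_spiral A f" and c0: "c0 \<in> A"
begin

lemma f_closed: "x \<in> A \<Longrightarrow> y \<in> A \<Longrightarrow> f x y \<in> A"
  and f_comm: "x \<in> A \<Longrightarrow> y \<in> A \<Longrightarrow> f x y = f y x"
  and f_idem: "x \<in> A \<Longrightarrow> f x x = x"
  using weak_spiral unfolding weak_spiral_def by blast+

lemma uniform_stable: "\<exists>N. \<forall>x\<in>A. \<forall>y\<in>A. f x ((f x ^^ N) y) = (f x ^^ N) y"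
proof -
  have "\<forall>p\<in>A \<times> A. \<exists>n. \<forall>k\<ge>n. f (fst p) ((f (fst p) ^^ k) (snd p)) = (f (fst p) ^^ k) (snd p)"
  proof
    fix p
    assume "p \<in> A \<times> A"
    then obtain c where "\<forall>\<^sub>F n in sequentially. (f (fst p) ^^ Suc n) (snd p) = c"
      using weak_spiral unfolding weak_spiral_def by (metis mem_Times_iff)
    then obtain n where n: "\<And>k. k \<ge> n \<Longrightarrow> (f (fst p) ^^ Suc k) (snd p) = c"
      unfolding eventually_sequentially by blast
    \<comment> \<open>The value \<open>c\<close> is known for exponents \<open>Suc k\<close> with
      \<open>k \<ge> n\<close>; the right-hand side has exponent \<open>k\<close> itself, hence the
      shift to \<open>Suc n\<close>.\<close>
    have "f (fst p) ((f (fst p) ^^ k) (snd p)) = (f (fst p) ^^ k) (snd p)" if "k \<ge> Suc n" for k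
    proof -
      obtain l where l: "k = Suc l" "l \<ge> n" using \<open>k \<ge> Suc n\<close> Suc_le_D by force
      show ?thesis using n[OF l(2)] n[of k] l by simp
    qed
    then show "\<exists>n. \<forall>k\<ge>n. f (fst p) ((f (fst p) ^^ k) (snd p)) = (f (fst p) ^^ k) (snd p)"
      by blast
  qed
  then obtain n where n: "\<And>p k. p \<in> A \<times> A \<Longrightarrow> k \<ge> n p \<Longrightarrow>
      f (fst p) ((f (fst p) ^^ k) (snd p)) = (f (fst p) ^^ k) (snd p)"
    by metis
  have "n p \<le> Max (n ` (A \<times> A))" if "p \<in> A \<times> A" for p
    using that finite_A by (intro Max_ge) auto
  then show ?thesis
    using n by (intro exI[of _ "Max (n ` (A \<times> A))"]) force
qed

definition stable_index :: nat where
  "stable_index = (SOME N. \<forall>x\<in>A. \<forall>y\<in>A. f x ((f x ^^ N) y) = (f x ^^ N) y)"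

lemma stable_index:
  "x \<in> A \<Longrightarrow> y \<in> A \<Longrightarrow> f x ((f x ^^ stable_index) y) = (f x ^^ stable_index) y"
  using someI_ex[OF uniform_stable] unfolding stable_index_def by blast

text \<open>The free algebra on two generators consists of binary operations on \<open>A\<close>, extended by
  \<open>c0\<close> outside \<open>A\<close>. An element of \<open>rel S\<close> is the tuple of the values of a term with
  variables in \<open>S\<close> that is evaluated, for each \<open>k \<in> S\<close>, at \<open>pi2\<close> in position \<open>k\<close> and \<open>pi1\<close>
  elsewhere.\<close>

definition opF :: "('a \<times> 'a \<Rightarrow> 'a) \<Rightarrow> ('a \<times> 'a \<Rightarrow> 'a) \<Rightarrow> 'a \<times> 'a \<Rightarrow> 'a" where
  "opF p q = (\<lambda>z. f (p z) (q z))"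

definition opR :: "(nat \<Rightarrow> 'a \<times> 'a \<Rightarrow> 'a) \<Rightarrow> (nat \<Rightarrow> 'a \<times> 'a \<Rightarrow> 'a) \<Rightarrow> nat \<Rightarrow> 'a \<times> 'a \<Rightarrow> 'a" where
  "opR r s = (\<lambda>k. opF (r k) (s k))"

definition pi1 :: "'a \<times> 'a \<Rightarrow> 'a" where
  "pi1 z = (if z \<in> A \<times> A then fst z else c0)"

definition pi2 :: "'a \<times> 'a \<Rightarrow> 'a" where
  "pi2 z = (if z \<in> A \<times> A then snd z else c0)"

text \<open>Tuples are functions on all of \<open>nat\<close>. The default \<open>c0\<close> outside
  \<open>S\<close> is preserved by idempotence and keeps \<open>rel S\<close> finite.\<close>

definition unit_tuple :: "nat set \<Rightarrow> nat \<Rightarrow> nat \<Rightarrow> 'a \<times> 'a \<Rightarrow> 'a" where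
  "unit_tuple S i k = (if k \<in> S then if k = i then pi2 else pi1 else (\<lambda>_. c0))"

definition rel :: "nat set \<Rightarrow> (nat \<Rightarrow> 'a \<times> 'a \<Rightarrow> 'a) set" where
  "rel S = generated opR (unit_tuple S ` S)"

definition free2 :: "('a \<times> 'a \<Rightarrow> 'a) set" where
  "free2 = generated opF {pi1, pi2}"

text \<open>This is the projection of \<open>rel S\<close> to any two coordinates of
  \<open>S\<close> if there is a third one, whose generator contributes \<open>(pi1, pi1)\<close>.
  It does not depend on \<open>S\<close>.\<close>

definition adj :: "(('a \<times> 'a \<Rightarrow> 'a) \<times> ('a \<times> 'a \<Rightarrow> 'a)) set" where
  "adj = generated (prod_op opF opF) {(pi1, pi1), (pi1, pi2), (pi2, pi1)}"

lemma opR_apply: "opR r s k = opF (r k) (s k)"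
  by (simp add: opR_def)

lemma opF_pi1: "opF pi1 pi1 = pi1"
  by (auto simp: opF_def pi1_def f_idem c0)

lemma rel_coordinate:
  assumes "k \<in> S" "l \<in> S" "k \<noteq> l"
  shows "(\<lambda>r. r k) ` rel S = free2"
proof -
  have "(\<lambda>r. r k) ` unit_tuple S ` S = {pi1, pi2}"
    using assms by (auto simp: unit_tuple_def image_iff)
  then show ?thesis
    unfolding rel_def free2_def by (subst generated_image[where g = opF]) (simp_all add: opR_apply)
qed

lemma rel_coordinates:
  assumes "k \<in> S" "l \<in> S" "j \<in> S" "k \<noteq> l" "j \<noteq> k" "j \<noteq> l"
  shows "(\<lambda>r. (r k, r l)) ` rel S = adj"
proof -
  have "(\<lambda>r. (r k, r l)) ` unit_tuple S ` S = {(pi1, pi1), (pi1, pi2), (pi2, pi1)}"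
    using assms by (auto simp: unit_tuple_def image_iff split: if_splits)
  then show ?thesis
    unfolding rel_def adj_def
    by (subst generated_image[where g = "prod_op opF opF"]) (simp_all add: opR_apply)
qed

text \<open>As \<open>pi1\<close> is idempotent, pairing with \<open>pi1\<close> is a homomorphism
  that sends the generators of \<open>free2\<close> to generators of \<open>adj\<close>. Hence any
  two elements of \<open>free2\<close> are joined by two steps through \<open>pi1\<close>.\<close>

lemma adj_pi1: "q \<in> free2 \<Longrightarrow> (pi1, q) \<in> adj" "q \<in> free2 \<Longrightarrow> (q, pi1) \<in> adj"
proof -
  have "(\<lambda>q. (pi1, q)) ` free2 = generated (prod_op opF opF) ((\<lambda>q. (pi1, q)) ` {pi1, pi2})"
    unfolding free2_def by (rule generated_image) (simp add: opF_pi1)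
  also have "\<dots> \<subseteq> adj" unfolding adj_def by (rule generated_mono) auto
  finally show "q \<in> free2 \<Longrightarrow> (pi1, q) \<in> adj" by blast
  have "(\<lambda>q. (q, pi1)) ` free2 = generated (prod_op opF opF) ((\<lambda>q. (q, pi1)) ` {pi1, pi2})"
    unfolding free2_def by (rule generated_image) (simp add: opF_pi1)
  also have "\<dots> \<subseteq> adj" unfolding adj_def by (rule generated_mono) auto
  finally show "q \<in> free2 \<Longrightarrow> (q, pi1) \<in> adj" by blast
qed

definition support_tuples :: "nat set \<Rightarrow> (nat \<Rightarrow> 'a \<times> 'a \<Rightarrow> 'a) set" where
  "support_tuples S = {r. \<forall>k z. (k \<in> S \<and> z \<in> A \<times> A \<longrightarrow> r k z \<in> A) \<and>
     (\<not> (k \<in> S \<and> z \<in> A \<times> A) \<longrightarrow> r k z = c0)}"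

lemma rel_subset: "rel S \<subseteq> support_tuples S"
  unfolding rel_def
proof (rule generated_minimal)
  show "unit_tuple S ` S \<subseteq> support_tuples S"
    by (auto simp: support_tuples_def unit_tuple_def pi1_def pi2_def)
  show "subalg opR (support_tuples S)"
    by (auto simp: subalg_def support_tuples_def opR_def opF_def f_closed f_idem c0)
qed

lemma finite_rel:
  assumes "finite S"
  shows "finite (rel S)"
proof -
  have "finite {g. \<forall>x. (x \<in> S \<times> A \<times> A \<longrightarrow> g x \<in> A) \<and> (x \<notin> S \<times> A \<times> A \<longrightarrow> g x = c0)}"
    using assms finite_A by (intro finite_set_of_finite_funs) auto
  then have "finite (curry ` {g. \<forall>x. (x \<in> S \<times> A \<times> A \<longrightarrow> g x \<in> A) \<and> (x \<notin> S \<times> A \<times> A \<longrightarrow> g x = c0)})"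
    by (rule finite_imageI)
  moreover have "support_tuples S \<subseteq>
      curry ` {g. \<forall>x. (x \<in> S \<times> A \<times> A \<longrightarrow> g x \<in> A) \<and> (x \<notin> S \<times> A \<times> A \<longrightarrow> g x = c0)}"
  proof
    fix r
    assume r: "r \<in> support_tuples S"
    have "r = curry (case_prod r)" by simp
    moreover have "case_prod r \<in>
        {g. \<forall>x. (x \<in> S \<times> A \<times> A \<longrightarrow> g x \<in> A) \<and> (x \<notin> S \<times> A \<times> A \<longrightarrow> g x = c0)}"
      using r unfolding support_tuples_def by auto
    ultimately show "r \<in> curry `
        {g. \<forall>x. (x \<in> S \<times> A \<times> A \<longrightarrow> g x \<in> A) \<and> (x \<notin> S \<times> A \<times> A \<longrightarrow> g x = c0)}"
      by blast
  qed
  ultimately have "finite (support_tuples S)" by (rule finite_subset[rotated])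
  then show ?thesis using rel_subset by (rule finite_subset[rotated])
qed

lemma finite_free2: "finite free2"
proof -
  have "(\<lambda>r. r (0::nat)) ` rel {0, 1} = free2"
    by (rule rel_coordinate[where l = 1]) auto
  then show ?thesis using finite_rel[of "{0, 1}"] by (metis finite.intros finite_imageI)
qed

definition ambient :: "(nat \<Rightarrow> 'a \<times> 'a \<Rightarrow> 'a) set" where
  "ambient = {r. \<forall>k z. r k z \<in> A}"

lemma opR_power: "(opR r ^^ n) s k z = (f (r k z) ^^ n) (s k z)"
  by (induction n) (auto simp: opR_def opF_def)

sublocale spiral opR ambient stable_index
proof
  show "comm_idem opR ambient"
    unfolding comm_idem_def
  proof (intro conjI ballI ext)
    fix x y k z
    assume "x \<in> ambient" "y \<in> ambient"
    then have "x k z \<in> A" "y k z \<in> A" unfolding ambient_def by blast+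
    then show "opR x y k z = opR y x k z" by (simp add: opR_def opF_def f_comm)
  next
    fix x k z
    assume "x \<in> ambient"
    then have "x k z \<in> A" unfolding ambient_def by blast
    then show "opR x x k z = x k z" by (simp add: opR_def opF_def f_idem)
  qed
  show "subalg opR ambient"
    by (auto simp: subalg_def ambient_def opR_def opF_def f_closed)
  show "opR x ((opR x ^^ stable_index) y) = (opR x ^^ stable_index) y"
    if "x \<in> ambient" "y \<in> ambient" for x y
  proof (intro ext)
    fix k z
    have xy: "x k z \<in> A" "y k z \<in> A" using that unfolding ambient_def by blast+
    show "opR x ((opR x ^^ stable_index) y) k z = (opR x ^^ stable_index) y k z"
      using stable_index[OF xy] opR_power[of stable_index x y k z]
      by (simp add: opR_def[of x "(opR x ^^ stable_index) y"] opF_def)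
  qed
qed

section \<open>The network of scopes\<close>

definition scopes :: "nat \<Rightarrow> nat set set" where
  "scopes m = {S. S \<subseteq> {..<m} \<and> (card S = 3 \<or> card S = 4)}"

definition agree :: "nat \<Rightarrow> nat set \<Rightarrow> nat set \<Rightarrow>
    ((nat \<Rightarrow> 'a \<times> 'a \<Rightarrow> 'a) \<times> (nat \<Rightarrow> 'a \<times> 'a \<Rightarrow> 'a)) set" where
  "agree k S T = {(r, s). r \<in> rel S \<and> s \<in> rel T \<and> r k = s k}"

definition adjacent :: "nat \<Rightarrow> nat \<Rightarrow> nat set \<Rightarrow> nat set \<Rightarrow>
    ((nat \<Rightarrow> 'a \<times> 'a \<Rightarrow> 'a) \<times> (nat \<Rightarrow> 'a \<times> 'a \<Rightarrow> 'a)) set" where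
  "adjacent k l S T = {(r, s). r \<in> rel S \<and> s \<in> rel T \<and> (r k, s l) \<in> adj}"

definition scope_edges :: "nat \<Rightarrow> (nat set, nat \<Rightarrow> 'a \<times> 'a \<Rightarrow> 'a) edge set" where
  "scope_edges m = {(S, agree k S T, T) |S T k. S \<in> scopes m \<and> T \<in> scopes m \<and> k \<in> S \<inter> T}"

lemma scope_third:
  assumes "S \<in> scopes m"
  obtains j where "j \<in> S" "j \<noteq> k" "j \<noteq> l"
proof -
  have "\<not> S \<subseteq> {k, l}"
  proof
    assume "S \<subseteq> {k, l}"
    then have "card S \<le> card {k, l}" by (intro card_mono) auto
    also have "\<dots> \<le> 2" by (simp add: card_insert_le_m1)
    finally show False using assms unfolding scopes_def by auto
  qed
  then show thesis using that by blast
qed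

lemma scope_coordinate:
  assumes "S \<in> scopes m" "k \<in> S"
  shows "(\<lambda>r. r k) ` rel S = free2"
proof -
  obtain l where "l \<in> S" "l \<noteq> k" using scope_third[OF assms(1)] by blast
  then show ?thesis using rel_coordinate[of k S l] assms(2) by blast
qed

lemma scope_coordinates:
  assumes "S \<in> scopes m" "k \<in> S" "l \<in> S" "k \<noteq> l"
  shows "(\<lambda>r. (r k, r l)) ` rel S = adj"
proof -
  obtain j where "j \<in> S" "j \<noteq> k" "j \<noteq> l" using scope_third[OF assms(1)] by blast
  then show ?thesis using rel_coordinates[of k S l j] assms by blast
qed

lemma coordinate_in:
  assumes "S \<in> scopes m" "k \<in> S" "r \<in> rel S"
  shows "r k \<in> free2"
  using imageI[OF assms(3), of "\<lambda>r. r k"] scope_coordinate[OF assms(1,2)] by simp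

lemma coordinate_ex:
  assumes "S \<in> scopes m" "k \<in> S" "q \<in> free2"
  shows "\<exists>r\<in>rel S. r k = q"
proof -
  have "q \<in> (\<lambda>r. r k) ` rel S" using scope_coordinate[OF assms(1,2)] assms(3) by simp
  then show ?thesis by blast
qed

lemma coordinates_in:
  assumes "S \<in> scopes m" "k \<in> S" "l \<in> S" "k \<noteq> l" "r \<in> rel S"
  shows "(r k, r l) \<in> adj"
  using imageI[OF assms(5), of "\<lambda>r. (r k, r l)"] scope_coordinates[OF assms(1-4)] by simp

lemma coordinates_ex:
  assumes "S \<in> scopes m" "k \<in> S" "l \<in> S" "k \<noteq> l" "(p, q) \<in> adj"
  shows "\<exists>r\<in>rel S. r k = p \<and> r l = q"
proof -
  have "(p, q) \<in> (\<lambda>r. (r k, r l)) ` rel S" using scope_coordinates[OF assms(1-4)] assms(5) by simp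
  then show ?thesis by blast
qed

lemma scope_network: "network opR ambient stable_index (scopes m) rel (scope_edges m)"
proof
  show "finite (scopes m)"
    by (rule finite_subset[of _ "Pow {..<m}"]) (auto simp: scopes_def)
next
  fix S
  assume S: "S \<in> scopes m"
  show "finite (rel S)"
    using S by (intro finite_rel) (auto simp: scopes_def intro: finite_subset)
  obtain k where "k \<in> S" using scope_third[OF S] by blast
  then show "rel S \<noteq> {}" unfolding rel_def by (auto intro: generated_base)
  show "subalg opR (rel S)" unfolding rel_def by (rule subalg_generated)
  show "rel S \<subseteq> ambient"
  proof
    fix r
    assume "r \<in> rel S"
    then have r: "r \<in> support_tuples S" using rel_subset by blast
    have "r k z \<in> A" for k z
    proof (cases "k \<in> S \<and> z \<in> A \<times> A")
      case True
      then show ?thesis using r unfolding support_tuples_def by blast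
    next
      case False
      then have "r k z = c0" using r unfolding support_tuples_def by blast
      then show ?thesis using c0 by simp
    qed
    then show "r \<in> ambient" unfolding ambient_def by blast
  qed
next
  fix S R T
  assume "(S, R, T) \<in> scope_edges m"
  then obtain k where R: "R = agree k S T" "S \<in> scopes m" "T \<in> scopes m" "k \<in> S" "k \<in> T"
    unfolding scope_edges_def by blast
  show "S \<in> scopes m \<and> T \<in> scopes m" using R by blast
  show "R \<subseteq> rel S \<times> rel T" unfolding R(1) agree_def by blast
  show "subalg (prod_op opR opR) R"
  proof (rule subalg_relI)
    fix a b c d
    assume "(a, b) \<in> R" "(c, d) \<in> R"
    then show "(opR a c, opR b d) \<in> R"
      unfolding R(1) agree_def rel_def by (auto simp: opR_apply intro: generated_op)
  qed
  show "\<exists>s. (r, s) \<in> R" if "r \<in> rel S" for r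
    using coordinate_ex[OF R(3,5) coordinate_in[OF R(2,4) that]] that unfolding R(1) agree_def by auto
  have "R\<inverse> = agree k T S" unfolding R(1) agree_def by auto
  then show "(T, R\<inverse>, S) \<in> scope_edges m"
    using R unfolding scope_edges_def by blast
qed

text \<open>These four forms are closed under appending an edge. Passing from one shared variable to
  another inside a scope turns agreement into \<open>adj\<close>; a second change gives everything,
  because \<open>adj\<close> joins \<open>pi1\<close> to every element on both sides.\<close>

lemma scope_path:
  assumes "path rel (scope_edges m) S P T" "S \<in> scopes m"
  shows "T \<in> scopes m \<and> (S = T \<and> P = Id_on (rel S) \<or> (\<exists>k\<in>S \<inter> T. P = agree k S T) \<or>
    (\<exists>k\<in>S. \<exists>l\<in>T. k \<noteq> l \<and> P = adjacent k l S T) \<or> P = rel S \<times> rel T)"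
  using assms
proof (induction rule: path.induct)
  case (path_step S P T R U)
  note S = path_step.prems
  obtain j where R: "R = agree j T U" "T \<in> scopes m" "U \<in> scopes m" "j \<in> T" "j \<in> U"
    using path_step.hyps(2) unfolding scope_edges_def by blast
  consider (id) "S = T" "P = Id_on (rel S)" | (ag) k where "k \<in> S" "k \<in> T" "P = agree k S T"
    | (adj) k l where "k \<in> S" "l \<in> T" "k \<noteq> l" "P = adjacent k l S T" | (full) "P = rel S \<times> rel T"
    using path_step.IH[OF S] by blast
  then have "(\<exists>k\<in>S \<inter> U. P O R = agree k S U) \<or>
    (\<exists>k\<in>S. \<exists>l\<in>U. k \<noteq> l \<and> P O R = adjacent k l S U) \<or> P O R = rel S \<times> rel U"
  proof cases
    case id
    then have eq: "P O R = agree j S U" unfolding R(1) agree_def by auto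
    show ?thesis by (intro disjI1 bexI[of _ j]) (use eq R id in simp_all)
  next
    case ag
    show ?thesis
    proof (cases "j = k")
      case True
      have eq: "P O R = agree k S U"
      proof
        show "agree k S U \<subseteq> P O R"
        proof clarify
          fix r u
          assume ru: "(r, u) \<in> agree k S U"
          then obtain t where "t \<in> rel T" "t k = r k"
            using coordinate_ex[OF R(2) ag(2)] coordinate_in[OF S ag(1)] unfolding agree_def by blast
          then have "(r, t) \<in> P" "(t, u) \<in> R"
            using ru unfolding ag(3) R(1) True agree_def by auto
          then show "(r, u) \<in> P O R" by blast
        qed
      qed (auto simp: ag(3) R(1) True agree_def)
      show ?thesis by (intro disjI1 bexI[of _ k]) (use eq True R(5) ag(1) in simp_all)
    next
      case False
      have eq: "P O R = adjacent k j S U"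
      proof
        show "P O R \<subseteq> adjacent k j S U"
        proof clarify
          fix r t u
          assume "(r, t) \<in> P" "(t, u) \<in> R"
          then have "r \<in> rel S" "t \<in> rel T" "u \<in> rel U" "r k = t k" "t j = u j"
            unfolding ag(3) R(1) agree_def by auto
          then show "(r, u) \<in> adjacent k j S U"
            using coordinates_in[OF R(2) ag(2) R(4), of t] False unfolding adjacent_def by auto
        qed
        show "adjacent k j S U \<subseteq> P O R"
        proof clarify
          fix r u
          assume ru: "(r, u) \<in> adjacent k j S U"
          then obtain t where "t \<in> rel T" "t k = r k" "t j = u j"
            using coordinates_ex[OF R(2) ag(2) R(4)] False unfolding adjacent_def by blast
          then have "(r, t) \<in> P" "(t, u) \<in> R"
            using ru unfolding ag(3) R(1) agree_def adjacent_def by auto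
          then show "(r, u) \<in> P O R" by blast
        qed
      qed
      have "\<exists>l\<in>U. k \<noteq> l \<and> P O R = adjacent k l S U"
        by (rule bexI[of _ j]) (use eq False R(5) in simp_all)
      then have "\<exists>k\<in>S. \<exists>l\<in>U. k \<noteq> l \<and> P O R = adjacent k l S U"
        using ag(1) by (rule bexI)
      then show ?thesis by (rule disjI2[OF disjI1])
    qed
  next
    case (adj k l)
    show ?thesis
    proof (cases "j = l")
      case True
      have eq: "P O R = adjacent k l S U"
      proof
        show "adjacent k l S U \<subseteq> P O R"
        proof clarify
          fix r u
          assume ru: "(r, u) \<in> adjacent k l S U"
          then have "u l \<in> free2"
            using coordinate_in[OF R(3,5)] True unfolding adjacent_def by blast
          then obtain t where "t \<in> rel T" "t l = u l"
            using coordinate_ex[OF R(2) adj(2)] by blast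
          then have "(r, t) \<in> P" "(t, u) \<in> R"
            using ru unfolding adj(4) R(1) True agree_def adjacent_def by auto
          then show "(r, u) \<in> P O R" by blast
        qed
      qed (auto simp: adj(4) R(1) True agree_def adjacent_def)
      have "\<exists>l\<in>U. k \<noteq> l \<and> P O R = adjacent k l S U"
        by (rule bexI[of _ l]) (use eq True R(5) adj(3) in simp_all)
      then have "\<exists>k\<in>S. \<exists>l\<in>U. k \<noteq> l \<and> P O R = adjacent k l S U"
        using adj(1) by (rule bexI)
      then show ?thesis by (rule disjI2[OF disjI1])
    next
      case False
      have "P O R = rel S \<times> rel U"
      proof
        show "rel S \<times> rel U \<subseteq> P O R"
        proof clarify
          fix r u
          assume ru: "r \<in> rel S" "u \<in> rel U"
          have "(pi1, u j) \<in> adj" using adj_pi1 coordinate_in[OF R(3,5) ru(2)] by blast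
          then obtain t where t: "t \<in> rel T" "t l = pi1" "t j = u j"
            using coordinates_ex[OF R(2) adj(2) R(4)] False by blast
          have "(r k, pi1) \<in> adj" using adj_pi1 coordinate_in[OF S adj(1) ru(1)] by blast
          then have "(r, t) \<in> P" "(t, u) \<in> R"
            using ru t unfolding adj(4) R(1) agree_def adjacent_def by auto
          then show "(r, u) \<in> P O R" by blast
        qed
      qed (auto simp: adj(4) R(1) agree_def adjacent_def)
      then show ?thesis by (rule disjI2[OF disjI2])
    qed
  next
    case full
    have "P O R = rel S \<times> rel U"
    proof
      show "rel S \<times> rel U \<subseteq> P O R"
      proof clarify
        fix r u
        assume ru: "r \<in> rel S" "u \<in> rel U"
        then obtain t where "t \<in> rel T" "t j = u j"
          using coordinate_ex[OF R(2,4)] coordinate_in[OF R(3,5)] by blast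
        then have "(r, t) \<in> P" "(t, u) \<in> R"
          using ru unfolding full R(1) agree_def by auto
        then show "(r, u) \<in> P O R" by blast
      qed
    qed (auto simp: full R(1) agree_def)
    then show ?thesis by (rule disjI2[OF disjI2])
  qed
  then show ?case using R(3) by blast
qed simp

text \<open>All closed path relations are reflexive; for \<open>adjacent k l\<close> this rests on
  \<open>k \<noteq> l\<close>. So it suffices to return from \<open>b\<close> to \<open>a\<close> in
  two steps of \<open>P\<close>, in the case of \<open>adjacent\<close> through a tuple with value
  \<open>pi1\<close> at \<open>k\<close> and \<open>l\<close>.\<close>

lemma scope_consistent: "consistent (scopes m) rel (scope_edges m)"
  unfolding consistent_def
proof (intro ballI allI impI, clarify)
  fix S P Q a b
  assume S: "S \<in> scopes m" and P: "path rel (scope_edges m) S P S"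
    and Q: "path rel (scope_edges m) S Q S" and ab: "(a, b) \<in> P"
  have refl: "(r, r) \<in> P" if "path rel (scope_edges m) S P S" "r \<in> rel S" for P r
    using scope_path[OF that(1) S] that(2) coordinates_in[OF S]
    by (auto simp: agree_def adjacent_def)
  have abS: "a \<in> rel S" "b \<in> rel S"
    using scope_path[OF P S] ab by (auto simp: agree_def adjacent_def)
  have "(b, a) \<in> P O P"
  proof -
    consider (sym) "(b, a) \<in> P" | (adj) k l where "k \<in> S" "l \<in> S" "k \<noteq> l" "P = adjacent k l S S"
      using scope_path[OF P S] ab by (auto simp: agree_def)
    then show ?thesis
    proof cases
      case sym
      then show ?thesis using refl[OF P abS(1)] by blast
    next
      case adj
      have "(pi1, pi1) \<in> adj" unfolding adj_def by (auto intro: generated_base)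
      then obtain t where t: "t \<in> rel S" "t k = pi1" "t l = pi1"
        using coordinates_ex[OF S adj(1-3)] by blast
      have "(b k, pi1) \<in> adj" "(pi1, a l) \<in> adj"
        using adj_pi1 coordinate_in[OF S] adj(1,2) abS by blast+
      then have "(b, t) \<in> P" "(t, a) \<in> P"
        unfolding adj(4) adjacent_def using t abS by auto
      then show ?thesis by blast
    qed
  qed
  then obtain t where t: "(b, t) \<in> P" "(t, a) \<in> P" by blast
  have "t \<in> rel S" using scope_path[OF P S] t by (auto simp: agree_def adjacent_def)
  then have "(b, t) \<in> Q O P" "(t, a) \<in> Q O P"
    using refl[OF Q] abS t by blast+
  then show "(b, a) \<in> (Q O P)\<^sup>*" by (meson r_into_rtrancl rtrancl_trans)
qed

section \<open>From a solution to the terms\<close>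

lemma rel_term:
  assumes "r \<in> rel S"
  shows "\<exists>t. tvars t \<subseteq> S \<and> (\<forall>k\<in>S. \<forall>x\<in>A. \<forall>y\<in>A. r k (x, y) = teval f (\<lambda>i. if i = k then y else x) t)"
  using assms unfolding rel_def
proof induction
  case (generated_base b)
  then obtain i where "i \<in> S" "b = unit_tuple S i" by blast
  then show ?case by (intro exI[of _ "Var i"]) (auto simp: unit_tuple_def pi1_def pi2_def)
next
  case (generated_op r s)
  then obtain t u where "tvars t \<subseteq> S"
    "\<forall>k\<in>S. \<forall>x\<in>A. \<forall>y\<in>A. r k (x, y) = teval f (\<lambda>i. if i = k then y else x) t"
    "tvars u \<subseteq> S"
    "\<forall>k\<in>S. \<forall>x\<in>A. \<forall>y\<in>A. s k (x, y) = teval f (\<lambda>i. if i = k then y else x) u"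
    by blast
  then show ?case by (intro exI[of _ "Op t u"]) (auto simp: opR_def opF_def)
qed

text \<open>The coordinates of \<open>r\<close> are the values of one term with \<open>y\<close> put
  in the different places, so a constant tuple means that the place does not matter. A bijection
  renames the variables in \<open>S\<close> to those below \<open>n\<close>.\<close>

lemma constant_tuple_term:
  assumes r: "r \<in> rel S" "\<And>k. k \<in> S \<Longrightarrow> r k = d" and S: "finite S" "card S = n"
  shows "\<exists>g. nary_term n g \<and>
    (\<forall>x\<in>A. \<forall>y\<in>A. \<forall>j<n. term_op f g ((replicate n x)[j := y]) = d (x, y))"
proof -
  obtain t where t: "tvars t \<subseteq> S"
    "\<And>k x y. k \<in> S \<Longrightarrow> x \<in> A \<Longrightarrow> y \<in> A \<Longrightarrow> r k (x, y) = teval f (\<lambda>i. if i = k then y else x) t"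
    using rel_term[OF r(1)] by blast
  obtain \<rho> where \<rho>: "bij_betw \<rho> S {0..<n}"
    using ex_bij_betw_finite_nat[OF S(1)] S(2) by blast
  have rho_less: "\<rho> i < n" if "i \<in> S" for i
    using \<rho> that unfolding bij_betw_def by auto
  have "term_op f (rename \<rho> t) ((replicate n x)[j := y]) = d (x, y)"
    if xy: "x \<in> A" "y \<in> A" and j: "j < n" for x y j
  proof -
    have "j \<in> \<rho> ` S" using \<rho> j unfolding bij_betw_def by auto
    then obtain k where k: "k \<in> S" "j = \<rho> k" by blast
    have "teval f (\<lambda>i. (replicate n x)[j := y] ! \<rho> i) t = teval f (\<lambda>i. if i = k then y else x) t"
    proof (rule teval_cong)
      fix i
      assume "i \<in> tvars t"
      then have i: "i \<in> S" using t(1) by blast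
      have "\<rho> i = j \<longleftrightarrow> i = k"
        using \<rho> i k unfolding bij_betw_def by (auto dest: inj_onD)
      then show "(replicate n x)[j := y] ! \<rho> i = (if i = k then y else x)"
        using rho_less[OF i] by (auto simp: nth_list_update)
    qed
    then show ?thesis
      using t(2)[OF k(1) xy] r(2)[OF k(1)] by (simp add: term_op_def teval_rename)
  qed
  moreover have "nary_term n (rename \<rho> t)"
    using t(1) rho_less unfolding nary_term_def tvars_rename by auto
  ultimately show ?thesis by blast
qed

lemma bounded_width: "bounded_width A f"
proof -
  define m where "m = 3 * card free2 + 1"
  obtain v where v: "\<forall>S\<in>scopes m. v S \<in> rel S" "\<forall>(S, R, T)\<in>scope_edges m. (v S, v T) \<in> R"
    using network_solution[OF scope_network scope_consistent] by blast
  have agree: "v S k = v T k" if "S \<in> scopes m" "T \<in> scopes m" "k \<in> S" "k \<in> T" for S T k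
  proof -
    have "(S, agree k S T, T) \<in> scope_edges m"
      unfolding scope_edges_def using that by blast
    from bspec[OF v(2) this] show ?thesis by (simp add: agree_def)
  qed
  \<comment> \<open>This gives \<open>m \<ge> 4\<close>, so every variable lies in a scope.\<close>
  have free2_pos: "card free2 > 0"
    using finite_free2 unfolding free2_def by (auto simp: card_gt_0_iff intro: generated_base)
  have scope_ex: "\<exists>S\<in>scopes m. k \<in> S" if "k < m" for k
  proof -
    have "2 \<le> card ({..<m} - {k})" using that free2_pos unfolding m_def by simp
    then obtain T where T: "T \<subseteq> {..<m} - {k}" "card T = 2" "finite T"
      by (rule obtain_subset_with_card_n)
    moreover from this have "k \<notin> T" by blast
    ultimately have "insert k T \<in> scopes m" using that unfolding scopes_def by auto
    then show ?thesis by blast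
  qed
  \<comment> \<open>The edges force all scopes that contain \<open>k\<close> to give it the same
    value, so any of them may be chosen.\<close>
  define w where "w k = v (SOME S. S \<in> scopes m \<and> k \<in> S) k" for k
  have w: "v S k = w k" if "S \<in> scopes m" "k \<in> S" for S k
  proof -
    have "\<exists>S. S \<in> scopes m \<and> k \<in> S" using that by blast
    from someI_ex[OF this] show ?thesis unfolding w_def using agree that by blast
  qed
  have w_free2: "w k \<in> free2" if k: "k < m" for k
  proof -
    obtain S where S: "S \<in> scopes m" "k \<in> S" using scope_ex[OF k] by blast
    then show ?thesis using coordinate_in[OF S bspec[OF v(1) S(1)]] w[OF S] by simp
  qed
  have "\<exists>d\<in>free2. card {k. k < m \<and> w k = d} \<ge> 4"
  proof (rule ccontr)
    assume "\<not> ?thesis"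
    then have "card {k. k < m \<and> w k = d} \<le> 3" if "d \<in> free2" for d
      using that by (force simp: not_le)
    then have "(\<Sum>d\<in>free2. card {k. k < m \<and> w k = d}) \<le> (\<Sum>d\<in>free2. 3)"
      by (intro sum_mono)
    moreover have "{..<m} \<subseteq> (\<Union>d\<in>free2. {k. k < m \<and> w k = d})"
      using w_free2 by auto
    then have "card {..<m} \<le> card (\<Union>d\<in>free2. {k. k < m \<and> w k = d})"
      using finite_free2 by (intro card_mono) auto
    then have "m \<le> (\<Sum>d\<in>free2. card {k. k < m \<and> w k = d})"
      using card_UN_le[OF finite_free2, of "\<lambda>d. {k. k < m \<and> w k = d}"] by simp
    ultimately show False unfolding m_def by simp
  qed
  then obtain d where "card {k. k < m \<and> w k = d} \<ge> 4" by blast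
  then obtain S4 where S4: "S4 \<subseteq> {k. k < m \<and> w k = d}" "card S4 = 4" "finite S4"
    by (rule obtain_subset_with_card_n)
  \<comment> \<open>Taking \<open>S3\<close> inside \<open>S4\<close> gives both terms the same
    value \<open>d\<close>, which links the identities of \<open>g\<close> to those of
    \<open>h\<close>.\<close>
  have "3 \<le> card S4" using S4 by simp
  then obtain S3 where S3: "S3 \<subseteq> S4" "card S3 = 3" "finite S3"
    by (rule obtain_subset_with_card_n)
  have "S4 \<subseteq> {..<m}" "S3 \<subseteq> {..<m}" using S4(1) S3(1) by auto
  then have sc: "S3 \<in> scopes m" "S4 \<in> scopes m"
    using S4(2) S3(2) unfolding scopes_def by simp_all
  have "v S4 k = d" if "k \<in> S4" for k using w[OF sc(2) that] S4(1) that by auto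
  from constant_tuple_term[OF bspec[OF v(1) sc(2)] this S4(3,2)]
  obtain h where h: "nary_term 4 h"
    "\<And>x y j. x \<in> A \<Longrightarrow> y \<in> A \<Longrightarrow> j < 4 \<Longrightarrow> term_op f h ((replicate 4 x)[j := y]) = d (x, y)"
    by blast
  have "v S3 k = d" if "k \<in> S3" for k using w[OF sc(1) that] S3(1) S4(1) that by auto
  from constant_tuple_term[OF bspec[OF v(1) sc(1)] this S3(3,2)]
  obtain g where g: "nary_term 3 g"
    "\<And>x y j. x \<in> A \<Longrightarrow> y \<in> A \<Longrightarrow> j < 3 \<Longrightarrow> term_op f g ((replicate 3 x)[j := y]) = d (x, y)"
    by blast
  have g3: "term_op f g [y, x, x] = d (x, y)" "term_op f g [x, y, x] = d (x, y)"
    "term_op f g [x, x, y] = d (x, y)" if "x \<in> A" "y \<in> A" for x y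
    using g(2)[OF that, of 0] g(2)[OF that, of 1] g(2)[OF that, of 2] by (simp_all add: eval_nat_numeral)
  have h4: "term_op f h [y, x, x, x] = d (x, y)" "term_op f h [x, y, x, x] = d (x, y)"
    "term_op f h [x, x, y, x] = d (x, y)" "term_op f h [x, x, x, y] = d (x, y)"
    if "x \<in> A" "y \<in> A" for x y
    using h(2)[OF that, of 0] h(2)[OF that, of 1] h(2)[OF that, of 2] h(2)[OF that, of 3]
    by (simp_all add: eval_nat_numeral)
  show ?thesis
    unfolding bounded_width_def
    by (rule exI[of _ g], rule exI[of _ h]) (use g(1) h(1) g3 h4 in simp)
qed

end

theorem proposition9:
  fixes A :: "'a set" and f :: "'a \<Rightarrow> 'a \<Rightarrow> 'a"
  assumes "finite A" and "weak_spiral A f"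
  shows "bounded_width A f"
proof (cases "A = {}")
  \<comment> \<open>The locale needs an element \<open>c0\<close>; over the empty algebra the
    identities hold vacuously.\<close>
  case True
  then show ?thesis
    unfolding bounded_width_def
    by (intro exI[of _ "Var 0"]) (simp add: nary_term_def)
next
  case False
  then obtain c0 where "c0 \<in> A" by blast
  then interpret finite_weak_spiral A f c0
    by unfold_locales (use assms in auto)
  show ?thesis by (rule bounded_width)
qed

end
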